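(* Let $P:\mathbb{C}^{\mathrm{op}}\to\mathbf{Pos}$ be a Boolean existential doctrine such that each fiber $P(A)$ is non-trivial (i.e. not a singleton), and whose base category $\mathbb{C}$ is small. Then the doctrine $\underrightarrow{P}:\underline{\mathbb{C}}^{\mathrm{op}}\to\mathbf{Pos}$ constructed from $P$ as described in the context is consistent.
   Context: **Doctrines.** $\mathbf{Pos}$ is the category of posets and monotone maps. A doctrine is a functor $P:\mathbb{C}^{\mathrm{op}}\to\mathbf{Pos}$ where $\mathbb{C}$ (the base category) has finite products; $\mathbf{t}$ is the terminal object, $!_A:A\to\mathbf{t}$ the unique arrow, $P(A)$ a fiber, $P(f)$ a reindexing. $P$ is primary if every $P(A)$ has finite meets (including $\top$), preserved by reindexings. $P$ is implicational if every $P(A)$ has finite meets and a Heyting implication $\to$, all preserved by reindexings. $P$ is Heyting if every $P(A)$ is a Heyting algebra and all of $\wedge,\top,\to,\vee,\bot$ are preserved by reindexings; it is Boolean if moreover $\lnot(-)=(-)\to\bot:P^{\mathrm{op}}\to P$ is an isomorphism. A primary doctrine $P$ is existential if for all objects $B,C$ the map $P(\mathrm{pr}_1):P(C)\to P(C\times B)$ has a left adjoint $\exists^B_C$ satisfying Beck–Chevalley ($\exists^B_C P(f\times \mathrm{id}_B)=P(f)\exists^B_{C'}$ for all $f:C\to C'$) and Frobenius reciprocity ($\exists^B_C(\alpha\wedge P(\mathrm{pr}_1)\beta)=\exists^B_C(\alpha)\wedge\beta$). **Consistent.** A doctrine $R:\mathbb{D}^{\mathrm{op}}\to\mathbf{Pos}$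 is consistent if there are $a,b\in R(\mathbf{t})$ with $a\nleq b$. **Construction of $\underline{P}$.** Let $P$ be implicational existential with $\mathbb{C}$ small. Let $\Lambda$ be the cardinality of $\bigsqcup_{X\in\mathrm{ob}\,\mathbb{C}}P(X)$, regarded as an initial ordinal. Let $J$ be the set of finite lists (including the empty list) of pairwise distinct elements of $\mathrm{ob}\,\mathbb{C}\times\Lambda$, preordered by inclusion of the sets of entries. For $\bar X=((X_1,x_1),\dots,(X_n,x_n))\in J$ write $\Pi\bar X=X_1\times\dots\times X_n$ (terminal if $\bar X=\emptyset$; $\mathbf{t}\times A$ is identified with $A$). For $\bar X\le\bar Y$ let $\pi_{\bar Y\bar X}:\Pi\bar Y\to\Pi\bar X$ be the map whose $i$-th component is the projection onto the factor given by the unique entry of $\bar Y$ equal to $(X_i,x_i)$. The category $\underline{\mathbb{C}}$ has the objects of $\mathbb{C}$; an arrow $A\dashrightarrow B$ is a class $[f,\bar X]$ with $\bar X\in J$ and $f:\Pi\bar X\times A\to B$ in $\mathbb{C}$, where $[f,\bar X]=[f',\bar Y]$ iff there is $\bar Z\ge\bar X,\bar Y$ with $f\circ(\pi_{\bar Z\bar X}\times\mathrm{id}_A)=f'\circ(\pi_{\bar Z\bar Y}\times\mathrm{id}_A)$; composition is computed over a common list by $[g,\bar Z]\circ[f,\bar Z]=[g\circ\langle\mathrm{pr}_{\Pi\bar Z},f\rangle,\bar Z]$. The doctrine $\underline{P}:\underline{\mathbb{C}}^{\mathrm{op}}\to\mathbf{Pos}$ has as elements of $\underline{P}(A)$ the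 classes $[\alpha,\bar X]$ with $\alpha\in P(\Pi\bar X\times A)$, where $[\alpha,\bar X]\le[\beta,\bar Y]$ (resp. $=$) iff there is $\bar Z\ge\bar X,\bar Y$ with $P(\pi_{\bar Z\bar X}\times\mathrm{id}_A)\alpha\le P(\pi_{\bar Z\bar Y}\times\mathrm{id}_A)\beta$ (resp. $=$) in $P(\Pi\bar Z\times A)$; reindexing over a common list is $\underline{P}([f,\bar Z])[\beta,\bar Z]=[P(\langle\mathrm{pr}_{\Pi\bar Z},f\rangle)\beta,\bar Z]$. It is the directed colimit over $J$ of the doctrines obtained by adding to $P$ a constant of sort $\Pi\bar X$; it is implicational and existential, with operations computed over a common list and $\underline{\exists}^B_A[\varphi,\bar X]=[\exists^B_{\Pi\bar X\times A}\varphi,\bar X]$. **Construction of $\underrightarrow{P}$.** For each object $B$ fix a listing $([\varphi^B_j,\bar X^{(B,j)}])_{j\in\Lambda}$ (repetitions allowed) of all elements of $\underline{P}(B)$, with fixed representatives $\bar X^{(B,j)}=((X_1^{(B,j)},x_1^{(B,j)}),\dots,(X_{n}^{(B,j)},x_{n}^{(B,j)}))\in J$, $n=n^{(B,j)}$, and $\varphi^B_j\in P(\Pi\bar X^{(B,j)}\times B)$. Define recursively $d^B_j$ as the smallest ordinal strictly greater than all $d^B_h$ with $h<j$ and than all $x_a^{(B,k)}$ with $k\le j$, $1\le a\le n^{(B,k)}$; the listings are assumed chosen so that all $d^B_j\in\Lambda$. Let $\bar X^{(B,j)}_\star\in J$ be $\bar X^{(B,j)}$ with $(B,d^B_j)$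 appended, let $\psi^B_j=\big(P(\mathrm{pr}_1)\exists^B_{\Pi\bar X^{(B,j)}}\varphi^B_j\to\varphi^B_j\big)\in P(\Pi\bar X^{(B,j)}\times B)$ with $\mathrm{pr}_1:\Pi\bar X^{(B,j)}\times B\to\Pi\bar X^{(B,j)}$, and consider $[\psi^B_j,\bar X^{(B,j)}_\star]\in\underline{P}(\mathbf{t})$. For a finite set $\mathcal{U}\subseteq\mathrm{ob}\,\mathbb{C}\times\Lambda$ put $\psi_{\mathcal{U}}=\bigwedge_{(B,j)\in\mathcal{U}}[\psi^B_j,\bar X^{(B,j)}_\star]\in\underline{P}(\mathbf{t})$. The doctrine $\underrightarrow{P}:\underline{\mathbb{C}}^{\mathrm{op}}\to\mathbf{Pos}$ has as elements of $\underrightarrow{P}(A)$ the classes $[a,\mathcal{U}]$ with $\mathcal{U}$ finite and $a\in\underline{P}(A)$, $a\le\underline{P}(!_A)\psi_{\mathcal{U}}$, where $[a,\mathcal{U}]\le[b,\mathcal{V}]$ (resp. $=$) iff there is a finite $\mathcal{W}\supseteq\mathcal{U}\cup\mathcal{V}$ with $a\wedge\underline{P}(!_A)\psi_{\mathcal{W}}\le b\wedge\underline{P}(!_A)\psi_{\mathcal{W}}$ (resp. $=$) in $\underline{P}(A)$; reindexing is induced by that of $\underline{P}$. It is the directed colimit of the doctrines obtained from $\underline{P}$ by adding the axiom $\psi_{\mathcal{U}}$; it is implicational and existential. *)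

theory Defs
  imports "HOL-Algebra.Galois_Connection"
begin

section \<open>Categories with finite products\<close>

text \<open>Objects and arrows form sets, so every category below is small. The terminal object and the
  binary products are chosen, but not assumed to be strict in any way.\<close>

record ('o, 'a) fp_cat =
  Obj :: "'o set"
  Arr :: "'a set"
  Dom :: "'a \<Rightarrow> 'o"
  Cod :: "'a \<Rightarrow> 'o"
  Ide :: "'o \<Rightarrow> 'a"
  Comp :: "'a \<Rightarrow> 'a \<Rightarrow> 'a" (infixr \<open>\<cdot>\<index>\<close> 70)
  Trm :: "'o"
  Prd :: "'o \<Rightarrow> 'o \<Rightarrow> 'o" (infixl \<open>\<boxtimes>\<index>\<close> 75)
  Pr1 :: "'o \<Rightarrow> 'o \<Rightarrow> 'a"
  Pr2 :: "'o \<Rightarrow> 'o \<Rightarrow> 'a"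

definition Hom :: "('o, 'a) fp_cat \<Rightarrow> 'o \<Rightarrow> 'o \<Rightarrow> 'a set" where
  "Hom C A B = {f \<in> Arr C. Dom C f = A \<and> Cod C f = B}"

locale category =
  fixes C :: "('o, 'a) fp_cat" (structure)
  assumes dom_obj: "f \<in> Arr C \<Longrightarrow> Dom C f \<in> Obj C"
    and cod_obj: "f \<in> Arr C \<Longrightarrow> Cod C f \<in> Obj C"
    and ide_hom: "A \<in> Obj C \<Longrightarrow> Ide C A \<in> Hom C A A"
    and comp_hom: "\<lbrakk>f \<in> Hom C A B; g \<in> Hom C B D\<rbrakk> \<Longrightarrow> g \<cdot> f \<in> Hom C A D"
    and comp_ide: "f \<in> Hom C A B \<Longrightarrow> f \<cdot> Ide C A = f"
    and ide_comp: "f \<in> Hom C A B \<Longrightarrow> Ide C B \<cdot> f = f"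
    and comp_assoc: "\<lbrakk>f \<in> Hom C A B; g \<in> Hom C B D; h \<in> Hom C D E\<rbrakk>
      \<Longrightarrow> (h \<cdot> g) \<cdot> f = h \<cdot> (g \<cdot> f)"

locale fp_category = category +
  assumes trm_obj: "Trm C \<in> Obj C"
    and trm_univ: "A \<in> Obj C \<Longrightarrow> \<exists>!f. f \<in> Hom C A (Trm C)"
    and prd_obj: "\<lbrakk>A \<in> Obj C; B \<in> Obj C\<rbrakk> \<Longrightarrow> A \<boxtimes> B \<in> Obj C"
    and pr1_hom: "\<lbrakk>A \<in> Obj C; B \<in> Obj C\<rbrakk> \<Longrightarrow> Pr1 C A B \<in> Hom C (A \<boxtimes> B) A"
    and pr2_hom: "\<lbrakk>A \<in> Obj C; B \<in> Obj C\<rbrakk> \<Longrightarrow> Pr2 C A B \<in> Hom C (A \<boxtimes> B) B"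
    and prd_univ: "\<lbrakk>A \<in> Obj C; B \<in> Obj C; f \<in> Hom C D A; g \<in> Hom C D B\<rbrakk>
      \<Longrightarrow> \<exists>!h. h \<in> Hom C D (A \<boxtimes> B) \<and> Pr1 C A B \<cdot> h = f \<and> Pr2 C A B \<cdot> h = g"

definition bang :: "('o, 'a) fp_cat \<Rightarrow> 'o \<Rightarrow> 'a" where
  "bang C A = (THE f. f \<in> Hom C A (Trm C))"

definition pair :: "('o, 'a) fp_cat \<Rightarrow> 'a \<Rightarrow> 'a \<Rightarrow> 'a" where
  "pair C f g = (THE h. h \<in> Hom C (Dom C f) (Cod C f \<boxtimes>\<^bsub>C\<^esub> Cod C g)
     \<and> Pr1 C (Cod C f) (Cod C g) \<cdot>\<^bsub>C\<^esub> h = f \<and> Pr2 C (Cod C f) (Cod C g) \<cdot>\<^bsub>C\<^esub> h = g)"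

text \<open>\<open>times_id C f A\<close> is $f \times \mathrm{id}_A$.\<close>

definition times_id :: "('o, 'a) fp_cat \<Rightarrow> 'a \<Rightarrow> 'o \<Rightarrow> 'a" where
  "times_id C f A = pair C (f \<cdot>\<^bsub>C\<^esub> Pr1 C (Dom C f) A) (Pr2 C (Dom C f) A)"


section \<open>Doctrines\<close>

record ('o, 'a, 'p) indexed_poset =
  Base :: "('o, 'a) fp_cat"
  Fib :: "'o \<Rightarrow> 'p gorder"
  Rx :: "'a \<Rightarrow> 'p \<Rightarrow> 'p"

locale doctrine = fp_category "Base P" for P :: "('o, 'a, 'p) indexed_poset" +
  assumes fib_poset: "A \<in> Obj (Base P) \<Longrightarrow> partial_order (Fib P A)"
    and rx_closed: "f \<in> Hom (Base P) A B \<Longrightarrow> Rx P f \<in> carrier (Fib P B) \<rightarrow> carrier (Fib P A)"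
    and rx_mono: "f \<in> Hom (Base P) A B \<Longrightarrow> isotone (Fib P B) (Fib P A) (Rx P f)"
    and rx_ide: "\<lbrakk>A \<in> Obj (Base P); x \<in> carrier (Fib P A)\<rbrakk> \<Longrightarrow> Rx P (Ide (Base P) A) x = x"
    and rx_comp: "\<lbrakk>f \<in> Hom (Base P) A B; g \<in> Hom (Base P) B D; x \<in> carrier (Fib P D)\<rbrakk>
      \<Longrightarrow> Rx P (g \<cdot>\<^bsub>Base P\<^esub> f) x = Rx P f (Rx P g x)"

locale primary_doctrine = doctrine +
  assumes fib_meet: "A \<in> Obj (Base P) \<Longrightarrow> lower_semilattice (Fib P A)"
    and fib_top: "A \<in> Obj (Base P) \<Longrightarrow> weak_partial_order_top (Fib P A)"
    and rx_meet: "\<lbrakk>f \<in> Hom (Base P) A B; x \<in> carrier (Fib P B); y \<in> carrier (Fib P B)\<rbrakk>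
      \<Longrightarrow> Rx P f (x \<sqinter>\<^bsub>Fib P B\<^esub> y) = Rx P f x \<sqinter>\<^bsub>Fib P A\<^esub> Rx P f y"
    and rx_top: "f \<in> Hom (Base P) A B \<Longrightarrow> Rx P f \<top>\<^bsub>Fib P B\<^esub> = \<top>\<^bsub>Fib P A\<^esub>"

definition is_himp :: "'p gorder \<Rightarrow> 'p \<Rightarrow> 'p \<Rightarrow> 'p \<Rightarrow> bool" where
  "is_himp L a b c \<longleftrightarrow> c \<in> carrier L \<and>
     (\<forall>x\<in>carrier L. x \<sqsubseteq>\<^bsub>L\<^esub> c \<longleftrightarrow> x \<sqinter>\<^bsub>L\<^esub> a \<sqsubseteq>\<^bsub>L\<^esub> b)"

definition himp :: "'p gorder \<Rightarrow> 'p \<Rightarrow> 'p \<Rightarrow> 'p" where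
  "himp L a b = (THE c. is_himp L a b c)"

locale implicational_doctrine = primary_doctrine +
  assumes fib_himp: "\<lbrakk>A \<in> Obj (Base P); x \<in> carrier (Fib P A); y \<in> carrier (Fib P A)\<rbrakk>
      \<Longrightarrow> \<exists>z. is_himp (Fib P A) x y z"
    and rx_himp: "\<lbrakk>f \<in> Hom (Base P) A B; x \<in> carrier (Fib P B); y \<in> carrier (Fib P B)\<rbrakk>
      \<Longrightarrow> Rx P f (himp (Fib P B) x y) = himp (Fib P A) (Rx P f x) (Rx P f y)"

locale heyting_doctrine = implicational_doctrine +
  assumes fib_lattice: "A \<in> Obj (Base P) \<Longrightarrow> bounded_lattice (Fib P A)"
    and rx_join: "\<lbrakk>f \<in> Hom (Base P) A B; x \<in> carrier (Fib P B); y \<in> carrier (Fib P B)\<rbrakk>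
      \<Longrightarrow> Rx P f (x \<squnion>\<^bsub>Fib P B\<^esub> y) = Rx P f x \<squnion>\<^bsub>Fib P A\<^esub> Rx P f y"
    and rx_bot: "f \<in> Hom (Base P) A B \<Longrightarrow> Rx P f \<bottom>\<^bsub>Fib P B\<^esub> = \<bottom>\<^bsub>Fib P A\<^esub>"

definition neg :: "'p gorder \<Rightarrow> 'p \<Rightarrow> 'p" where
  "neg L a = himp L a \<bottom>\<^bsub>L\<^esub>"

text \<open>Negation is natural in every Heyting doctrine, so it is an isomorphism of doctrines from
  $P^{\mathrm{op}}$ to $P$ as soon as each component is an isomorphism of posets.\<close>

locale boolean_doctrine = heyting_doctrine +
  assumes neg_bij: "A \<in> Obj (Base P)
      \<Longrightarrow> bij_betw (neg (Fib P A)) (carrier (Fib P A)) (carrier (Fib P A))"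
    and neg_emb: "A \<in> Obj (Base P)
      \<Longrightarrow> order_emb (inv_gorder (Fib P A)) (Fib P A) (neg (Fib P A))"

text \<open>\<open>is_exq P D B e\<close>: the map \<open>e\<close> is left adjoint to reindexing along the projection
  $D \times B \to D$. Its values on the fiber are then uniquely determined.\<close>

definition is_exq :: "('o, 'a, 'p) indexed_poset \<Rightarrow> 'o \<Rightarrow> 'o \<Rightarrow> ('p \<Rightarrow> 'p) \<Rightarrow> bool" where
  "is_exq P D B e \<longleftrightarrow> galois_connection
     \<lparr>orderA = Fib P (D \<boxtimes>\<^bsub>Base P\<^esub> B), orderB = Fib P D, lower = e, upper = Rx P (Pr1 (Base P) D B)\<rparr>"

definition exq :: "('o, 'a, 'p) indexed_poset \<Rightarrow> 'o \<Rightarrow> 'o \<Rightarrow> 'p \<Rightarrow> 'p" where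
  "exq P D B = (SOME e. is_exq P D B e)"

locale existential_doctrine = primary_doctrine +
  assumes exq_ex: "\<lbrakk>B \<in> Obj (Base P); D \<in> Obj (Base P)\<rbrakk> \<Longrightarrow> \<exists>e. is_exq P D B e"
    and beck_chevalley: "\<lbrakk>B \<in> Obj (Base P); f \<in> Hom (Base P) D D';
        x \<in> carrier (Fib P (D' \<boxtimes>\<^bsub>Base P\<^esub> B))\<rbrakk>
      \<Longrightarrow> exq P D B (Rx P (times_id (Base P) f B) x) = Rx P f (exq P D' B x)"
    and frobenius: "\<lbrakk>B \<in> Obj (Base P); D \<in> Obj (Base P);
        x \<in> carrier (Fib P (D \<boxtimes>\<^bsub>Base P\<^esub> B)); y \<in> carrier (Fib P D)\<rbrakk>
      \<Longrightarrow> exq P D B (x \<sqinter>\<^bsub>Fib P (D \<boxtimes>\<^bsub>Base P\<^esub> B)\<^esub> Rx P (Pr1 (Base P) D B) y)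
          = exq P D B x \<sqinter>\<^bsub>Fib P D\<^esub> y"

definition consistent :: "('o, 'a, 'p) indexed_poset \<Rightarrow> bool" where
  "consistent R \<longleftrightarrow> (\<exists>a\<in>carrier (Fib R (Trm (Base R))). \<exists>b\<in>carrier (Fib R (Trm (Base R))).
     \<not> a \<sqsubseteq>\<^bsub>Fib R (Trm (Base R))\<^esub> b)"


section \<open>Adding constants\<close>

text \<open>The initial ordinal $\Lambda$ is represented by a well-order relation \<open>\<Lambda>\<close>; its elements are
  those of \<open>Field \<Lambda>\<close>.\<close>

type_synonym ('o, 'l) ctx = "('o \<times> 'l) list"

definition Ctx :: "('o, 'a) fp_cat \<Rightarrow> 'l rel \<Rightarrow> ('o, 'l) ctx set" where
  "Ctx C \<Lambda> = {xs. distinct xs \<and> set xs \<subseteq> Obj C \<times> Field \<Lambda>}"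

text \<open>Products of lists are bracketed to the left and start from the terminal object, so that
  appending an entry $(B, x)$ to \<open>xs\<close> gives \<open>LPrd C xs \<boxtimes>\<^bsub>C\<^esub> B\<close> on the nose.\<close>

definition LPrd :: "('o, 'a) fp_cat \<Rightarrow> ('o, 'l) ctx \<Rightarrow> 'o" where
  "LPrd C xs = foldl (\<lambda>D e. D \<boxtimes>\<^bsub>C\<^esub> fst e) (Trm C) xs"

text \<open>The projection onto the factor of an entry, by recursion on the reversed list.\<close>

primrec entry_proj_rev :: "('o, 'a) fp_cat \<Rightarrow> ('o, 'l) ctx \<Rightarrow> 'o \<times> 'l \<Rightarrow> 'a" where
  "entry_proj_rev C [] e = undefined"
| "entry_proj_rev C (a # as) e =
     (if a = e then Pr2 C (LPrd C (rev as)) (fst a)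
      else entry_proj_rev C as e \<cdot>\<^bsub>C\<^esub> Pr1 C (LPrd C (rev as)) (fst a))"

definition entry_proj :: "('o, 'a) fp_cat \<Rightarrow> ('o, 'l) ctx \<Rightarrow> 'o \<times> 'l \<Rightarrow> 'a" where
  "entry_proj C xs e = entry_proj_rev C (rev xs) e"

text \<open>\<open>ctx_proj C ys xs\<close> is the map $\pi_{\bar Y \bar X}$.\<close>

definition ctx_proj :: "('o, 'a) fp_cat \<Rightarrow> ('o, 'l) ctx \<Rightarrow> ('o, 'l) ctx \<Rightarrow> 'a" where
  "ctx_proj C ys xs = (THE h. h \<in> Hom C (LPrd C ys) (LPrd C xs) \<and>
     (\<forall>e\<in>set xs. entry_proj C xs e \<cdot>\<^bsub>C\<^esub> h = entry_proj C ys e))"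

abbreviation wk :: "('o, 'a) fp_cat \<Rightarrow> ('o, 'l) ctx \<Rightarrow> ('o, 'l) ctx \<Rightarrow> 'o \<Rightarrow> 'a" where
  "wk C zs xs A \<equiv> times_id C (ctx_proj C zs xs) A"

text \<open>\<open>graph C zs f A\<close> is $\langle \mathrm{pr}_{\Pi \bar Z}, f \rangle$ for
  $f : \Pi \bar Z \times A \to B$.\<close>

definition graph :: "('o, 'a) fp_cat \<Rightarrow> ('o, 'l) ctx \<Rightarrow> 'a \<Rightarrow> 'o \<Rightarrow> 'a" where
  "graph C zs f A = pair C (Pr1 C (LPrd C zs) A) f"

definition arr_reps :: "('o, 'a) fp_cat \<Rightarrow> 'l rel \<Rightarrow> 'o \<Rightarrow> 'o \<Rightarrow> ('a \<times> ('o, 'l) ctx) set" where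
  "arr_reps C \<Lambda> A B = {(f, xs). xs \<in> Ctx C \<Lambda> \<and> f \<in> Hom C (LPrd C xs \<boxtimes>\<^bsub>C\<^esub> A) B}"

definition arr_rel :: "('o, 'a) fp_cat \<Rightarrow> 'l rel \<Rightarrow> 'o \<Rightarrow> 'o \<Rightarrow> ('a \<times> ('o, 'l) ctx) rel" where
  "arr_rel C \<Lambda> A B = {((f, xs), (g, ys)). (f, xs) \<in> arr_reps C \<Lambda> A B \<and> (g, ys) \<in> arr_reps C \<Lambda> A B \<and>
     (\<exists>zs\<in>Ctx C \<Lambda>. set xs \<subseteq> set zs \<and> set ys \<subseteq> set zs \<and>
        f \<cdot>\<^bsub>C\<^esub> wk C zs xs A = g \<cdot>\<^bsub>C\<^esub> wk C zs ys A)}"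

text \<open>An arrow carries its domain and codomain, because products need not determine their factors
  and the same class can therefore occur for different \<open>A\<close>.\<close>

type_synonym ('o, 'a, 'l) carr = "'o \<times> 'o \<times> ('a \<times> ('o, 'l) ctx) set"

definition arr_cls :: "('o, 'a) fp_cat \<Rightarrow> 'l rel \<Rightarrow> 'o \<Rightarrow> 'o \<Rightarrow> 'a \<Rightarrow> ('o, 'l) ctx
    \<Rightarrow> ('a \<times> ('o, 'l) ctx) set" where
  "arr_cls C \<Lambda> A B f xs = arr_rel C \<Lambda> A B `` {(f, xs)}"

text \<open>Here and below, an operation on classes that is computed on representatives over a common list
  is written as the union of the resulting classes over all such representatives; as the operations
  are well defined, these classes are all equal.\<close>

definition const_cat :: "('o, 'a) fp_cat \<Rightarrow> 'l rel \<Rightarrow> ('o, ('o, 'a, 'l) carr) fp_cat" where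
  "const_cat C \<Lambda> =
    \<lparr>Obj = Obj C,
     Arr = {(A, B, k). A \<in> Obj C \<and> B \<in> Obj C \<and> k \<in> arr_reps C \<Lambda> A B // arr_rel C \<Lambda> A B},
     Dom = (\<lambda>(A, B, k). A),
     Cod = (\<lambda>(A, B, k). B),
     Ide = (\<lambda>A. (A, A, arr_cls C \<Lambda> A A (Pr2 C (Trm C) A) [])),
     Comp = (\<lambda>(B', D, l) (A, B, k).
       (A, D, \<Union>{arr_cls C \<Lambda> A D (g \<cdot>\<^bsub>C\<^esub> graph C zs f A) zs | f g zs. (f, zs) \<in> k \<and> (g, zs) \<in> l})),
     Trm = Trm C,
     Prd = Prd C,
     Pr1 = (\<lambda>A B. (A \<boxtimes>\<^bsub>C\<^esub> B, A,
       arr_cls C \<Lambda> (A \<boxtimes>\<^bsub>C\<^esub> B) A (Pr1 C A B \<cdot>\<^bsub>C\<^esub> Pr2 C (Trm C) (A \<boxtimes>\<^bsub>C\<^esub> B)) [])),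
     Pr2 = (\<lambda>A B. (A \<boxtimes>\<^bsub>C\<^esub> B, B,
       arr_cls C \<Lambda> (A \<boxtimes>\<^bsub>C\<^esub> B) B (Pr2 C A B \<cdot>\<^bsub>C\<^esub> Pr2 C (Trm C) (A \<boxtimes>\<^bsub>C\<^esub> B)) []))\<rparr>"

type_synonym ('o, 'p, 'l) cform = "('p \<times> ('o, 'l) ctx) set"

definition form_reps :: "('o, 'a, 'p) indexed_poset \<Rightarrow> 'l rel \<Rightarrow> 'o \<Rightarrow> ('p \<times> ('o, 'l) ctx) set" where
  "form_reps P \<Lambda> A = {(\<alpha>, xs). xs \<in> Ctx (Base P) \<Lambda> \<and>
     \<alpha> \<in> carrier (Fib P (LPrd (Base P) xs \<boxtimes>\<^bsub>Base P\<^esub> A))}"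

definition form_rel :: "('o, 'a, 'p) indexed_poset \<Rightarrow> 'l rel \<Rightarrow> 'o \<Rightarrow> ('p \<times> ('o, 'l) ctx) rel" where
  "form_rel P \<Lambda> A = {((\<alpha>, xs), (\<beta>, ys)). (\<alpha>, xs) \<in> form_reps P \<Lambda> A \<and> (\<beta>, ys) \<in> form_reps P \<Lambda> A \<and>
     (\<exists>zs\<in>Ctx (Base P) \<Lambda>. set xs \<subseteq> set zs \<and> set ys \<subseteq> set zs \<and>
        Rx P (wk (Base P) zs xs A) \<alpha> = Rx P (wk (Base P) zs ys A) \<beta>)}"

definition form_cls :: "('o, 'a, 'p) indexed_poset \<Rightarrow> 'l rel \<Rightarrow> 'o \<Rightarrow> 'p \<Rightarrow> ('o, 'l) ctx
    \<Rightarrow> ('o, 'p, 'l) cform" where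
  "form_cls P \<Lambda> A \<alpha> xs = form_rel P \<Lambda> A `` {(\<alpha>, xs)}"

definition form_le :: "('o, 'a, 'p) indexed_poset \<Rightarrow> 'l rel \<Rightarrow> 'o
    \<Rightarrow> ('o, 'p, 'l) cform \<Rightarrow> ('o, 'p, 'l) cform \<Rightarrow> bool" where
  "form_le P \<Lambda> A k l \<longleftrightarrow> (\<exists>(\<alpha>, xs)\<in>k. \<exists>(\<beta>, ys)\<in>l. \<exists>zs\<in>Ctx (Base P) \<Lambda>.
     set xs \<subseteq> set zs \<and> set ys \<subseteq> set zs \<and>
     Rx P (wk (Base P) zs xs A) \<alpha>
       \<sqsubseteq>\<^bsub>Fib P (LPrd (Base P) zs \<boxtimes>\<^bsub>Base P\<^esub> A)\<^esub> Rx P (wk (Base P) zs ys A) \<beta>)"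

definition const_doctrine :: "('o, 'a, 'p) indexed_poset \<Rightarrow> 'l rel
    \<Rightarrow> ('o, ('o, 'a, 'l) carr, ('o, 'p, 'l) cform) indexed_poset" where
  "const_doctrine P \<Lambda> =
    \<lparr>Base = const_cat (Base P) \<Lambda>,
     Fib = (\<lambda>A. \<lparr>carrier = form_reps P \<Lambda> A // form_rel P \<Lambda> A, eq = (=), le = form_le P \<Lambda> A\<rparr>),
     Rx = (\<lambda>(A, B, k) l.
       \<Union>{form_cls P \<Lambda> A (Rx P (graph (Base P) zs f A) \<beta>) zs | f \<beta> zs. (f, zs) \<in> k \<and> (\<beta>, zs) \<in> l})\<rparr>"


section \<open>Adding the Henkin axioms\<close>

text \<open>The listing of $\underline{P}(B)$ is given by representatives
  \<open>\<phi> B j\<close> over the list \<open>X B j\<close>, for \<open>j \<in> Field \<Lambda>\<close>.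

  \<open>d_bounds \<Lambda> X B d j\<close> collects the ordinals that the \<open>j\<close>-th value has to exceed strictly, and
  \<open>wo_rel.suc \<Lambda> S\<close> is the least strict upper bound of \<open>S\<close> in \<open>\<Lambda>\<close> if there is one.\<close>

definition d_bounds :: "'l rel \<Rightarrow> ('o \<Rightarrow> 'l \<Rightarrow> ('o, 'l) ctx) \<Rightarrow> 'o \<Rightarrow> ('l \<Rightarrow> 'l) \<Rightarrow> 'l \<Rightarrow> 'l set" where
  "d_bounds \<Lambda> X B d j = d ` underS \<Lambda> j \<union> (\<Union>k\<in>under \<Lambda> j. snd ` set (X B k))"

definition d_ord :: "'l rel \<Rightarrow> ('o \<Rightarrow> 'l \<Rightarrow> ('o, 'l) ctx) \<Rightarrow> 'o \<Rightarrow> 'l \<Rightarrow> 'l" where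
  "d_ord \<Lambda> X B = wo_rel.worec \<Lambda> (\<lambda>d j. wo_rel.suc \<Lambda> (d_bounds \<Lambda> X B d j))"

text \<open>The last condition says that all values of \<open>d_ord\<close> exist in \<open>\<Lambda>\<close>.\<close>

definition henkin_listing :: "('o, 'a, 'p) indexed_poset \<Rightarrow> 'l rel \<Rightarrow> ('o \<Rightarrow> 'l \<Rightarrow> 'p)
    \<Rightarrow> ('o \<Rightarrow> 'l \<Rightarrow> ('o, 'l) ctx) \<Rightarrow> bool" where
  "henkin_listing P \<Lambda> \<phi> X \<longleftrightarrow> (\<forall>B\<in>Obj (Base P).
     (\<forall>j\<in>Field \<Lambda>. (\<phi> B j, X B j) \<in> form_reps P \<Lambda> B) \<and>
     (\<forall>k\<in>carrier (Fib (const_doctrine P \<Lambda>) B). \<exists>j\<in>Field \<Lambda>. k = form_cls P \<Lambda> B (\<phi> B j) (X B j)) \<and>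
     (\<forall>j\<in>Field \<Lambda>. AboveS \<Lambda> (d_bounds \<Lambda> X B (d_ord \<Lambda> X B) j) \<noteq> {}))"

definition X_star :: "'l rel \<Rightarrow> ('o \<Rightarrow> 'l \<Rightarrow> ('o, 'l) ctx) \<Rightarrow> 'o \<Rightarrow> 'l \<Rightarrow> ('o, 'l) ctx" where
  "X_star \<Lambda> X B j = X B j @ [(B, d_ord \<Lambda> X B j)]"

definition henkin_form :: "('o, 'a, 'p) indexed_poset \<Rightarrow> ('o \<Rightarrow> 'l \<Rightarrow> 'p)
    \<Rightarrow> ('o \<Rightarrow> 'l \<Rightarrow> ('o, 'l) ctx) \<Rightarrow> 'o \<Rightarrow> 'l \<Rightarrow> 'p" where
  "henkin_form P \<phi> X B j = (let D = LPrd (Base P) (X B j) in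
     himp (Fib P (D \<boxtimes>\<^bsub>Base P\<^esub> B)) (Rx P (Pr1 (Base P) D B) (exq P D B (\<phi> B j))) (\<phi> B j))"

text \<open>\<open>henkin_form P \<phi> X B j\<close> lives over \<open>LPrd (Base P) (X_star \<Lambda> X B j)\<close>; a representative of
  an element of $\underline{P}(\mathbf{t})$ lives over the product of that object with
  $\mathbf{t}$, whence the reindexing along the isomorphism \<open>Pr1\<close>.\<close>

definition henkin_axiom :: "('o, 'a, 'p) indexed_poset \<Rightarrow> 'l rel \<Rightarrow> ('o \<Rightarrow> 'l \<Rightarrow> 'p)
    \<Rightarrow> ('o \<Rightarrow> 'l \<Rightarrow> ('o, 'l) ctx) \<Rightarrow> 'o \<Rightarrow> 'l \<Rightarrow> ('o, 'p, 'l) cform" where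
  "henkin_axiom P \<Lambda> \<phi> X B j = form_cls P \<Lambda> (Trm (Base P))
     (Rx P (Pr1 (Base P) (LPrd (Base P) (X_star \<Lambda> X B j)) (Trm (Base P))) (henkin_form P \<phi> X B j))
     (X_star \<Lambda> X B j)"

definition henkin_conj :: "('o, 'a, 'p) indexed_poset \<Rightarrow> 'l rel \<Rightarrow> ('o \<Rightarrow> 'l \<Rightarrow> 'p)
    \<Rightarrow> ('o \<Rightarrow> 'l \<Rightarrow> ('o, 'l) ctx) \<Rightarrow> ('o \<times> 'l) set \<Rightarrow> ('o, 'p, 'l) cform" where
  "henkin_conj P \<Lambda> \<phi> X U =
     \<Sqinter>\<^bsub>Fib (const_doctrine P \<Lambda>) (Trm (Base P))\<^esub> ((\<lambda>(B, j). henkin_axiom P \<Lambda> \<phi> X B j) ` U)"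

text \<open>\<open>henkin_conj_at P \<Lambda> \<phi> X A U\<close> is $\underline{P}(!_A)\psi_{\mathcal{U}}$.\<close>

definition henkin_conj_at :: "('o, 'a, 'p) indexed_poset \<Rightarrow> 'l rel \<Rightarrow> ('o \<Rightarrow> 'l \<Rightarrow> 'p)
    \<Rightarrow> ('o \<Rightarrow> 'l \<Rightarrow> ('o, 'l) ctx) \<Rightarrow> 'o \<Rightarrow> ('o \<times> 'l) set \<Rightarrow> ('o, 'p, 'l) cform" where
  "henkin_conj_at P \<Lambda> \<phi> X A U =
     Rx (const_doctrine P \<Lambda>) (bang (const_cat (Base P) \<Lambda>) A) (henkin_conj P \<Lambda> \<phi> X U)"

definition axiom_sets :: "('o, 'a, 'p) indexed_poset \<Rightarrow> 'l rel \<Rightarrow> ('o \<times> 'l) set set" where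
  "axiom_sets P \<Lambda> = {U. finite U \<and> U \<subseteq> Obj (Base P) \<times> Field \<Lambda>}"

type_synonym ('o, 'p, 'l) hform = "(('o, 'p, 'l) cform \<times> ('o \<times> 'l) set) set"

definition hreps :: "('o, 'a, 'p) indexed_poset \<Rightarrow> 'l rel \<Rightarrow> ('o \<Rightarrow> 'l \<Rightarrow> 'p)
    \<Rightarrow> ('o \<Rightarrow> 'l \<Rightarrow> ('o, 'l) ctx) \<Rightarrow> 'o \<Rightarrow> ('o, 'p, 'l) hform" where
  "hreps P \<Lambda> \<phi> X A = {(a, U). U \<in> axiom_sets P \<Lambda> \<and> a \<in> carrier (Fib (const_doctrine P \<Lambda>) A) \<and>
     a \<sqsubseteq>\<^bsub>Fib (const_doctrine P \<Lambda>) A\<^esub> henkin_conj_at P \<Lambda> \<phi> X A U}"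

definition hrel :: "('o, 'a, 'p) indexed_poset \<Rightarrow> 'l rel \<Rightarrow> ('o \<Rightarrow> 'l \<Rightarrow> 'p)
    \<Rightarrow> ('o \<Rightarrow> 'l \<Rightarrow> ('o, 'l) ctx) \<Rightarrow> 'o \<Rightarrow> (('o, 'p, 'l) cform \<times> ('o \<times> 'l) set) rel" where
  "hrel P \<Lambda> \<phi> X A = {((a, U), (b, V)). (a, U) \<in> hreps P \<Lambda> \<phi> X A \<and> (b, V) \<in> hreps P \<Lambda> \<phi> X A \<and>
     (\<exists>W\<in>axiom_sets P \<Lambda>. U \<union> V \<subseteq> W \<and>
        a \<sqinter>\<^bsub>Fib (const_doctrine P \<Lambda>) A\<^esub> henkin_conj_at P \<Lambda> \<phi> X A W
        = b \<sqinter>\<^bsub>Fib (const_doctrine P \<Lambda>) A\<^esub> henkin_conj_at P \<Lambda> \<phi> X A W)}"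

definition hle :: "('o, 'a, 'p) indexed_poset \<Rightarrow> 'l rel \<Rightarrow> ('o \<Rightarrow> 'l \<Rightarrow> 'p)
    \<Rightarrow> ('o \<Rightarrow> 'l \<Rightarrow> ('o, 'l) ctx) \<Rightarrow> 'o \<Rightarrow> ('o, 'p, 'l) hform \<Rightarrow> ('o, 'p, 'l) hform \<Rightarrow> bool" where
  "hle P \<Lambda> \<phi> X A k l \<longleftrightarrow> (\<exists>(a, U)\<in>k. \<exists>(b, V)\<in>l. \<exists>W\<in>axiom_sets P \<Lambda>. U \<union> V \<subseteq> W \<and>
     a \<sqinter>\<^bsub>Fib (const_doctrine P \<Lambda>) A\<^esub> henkin_conj_at P \<Lambda> \<phi> X A W
     \<sqsubseteq>\<^bsub>Fib (const_doctrine P \<Lambda>) A\<^esub> b \<sqinter>\<^bsub>Fib (const_doctrine P \<Lambda>) A\<^esub> henkin_conj_at P \<Lambda> \<phi> X A W)"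

definition henkin_doctrine :: "('o, 'a, 'p) indexed_poset \<Rightarrow> 'l rel \<Rightarrow> ('o \<Rightarrow> 'l \<Rightarrow> 'p)
    \<Rightarrow> ('o \<Rightarrow> 'l \<Rightarrow> ('o, 'l) ctx) \<Rightarrow> ('o, ('o, 'a, 'l) carr, ('o, 'p, 'l) hform) indexed_poset" where
  "henkin_doctrine P \<Lambda> \<phi> X =
    \<lparr>Base = const_cat (Base P) \<Lambda>,
     Fib = (\<lambda>A. \<lparr>carrier = hreps P \<Lambda> \<phi> X A // hrel P \<Lambda> \<phi> X A, eq = (=), le = hle P \<Lambda> \<phi> X A\<rparr>),
     Rx = (\<lambda>F k. \<Union>{hrel P \<Lambda> \<phi> X (Dom (const_cat (Base P) \<Lambda>) F) ``
         {(Rx (const_doctrine P \<Lambda>) F a, U)} | a U. (a, U) \<in> k})\<rparr>"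

unbundle cardinal_syntax

end

theory Submission
  imports Defs
begin

text \<open>Inconsistency of the Henkin doctrine means that finitely many Henkin axioms have meet below
  \<open>\<bottom>\<close> in $P(\Pi \bar Z)$ for some list $\bar Z$. Among these axioms choose one, of sort \<open>B\<close>, whose
  constant has the largest ordinal \<open>d\<close>. Its constant occurs in none of the others, so after a
  permutation $\bar Z$ is $\bar Y$ followed by that constant, and the other axioms come from some
  $c \in P(\Pi \bar Y)$. From $\mathrm{pr}_1^* c \wedge (\mathrm{pr}_1^* \exists \varphi \to \varphi) \le \bot$
  one gets $\varphi \le \mathrm{pr}_1^* \neg c$, hence $\exists \varphi \le \neg c$, so
  $\mathrm{pr}_1^* c \wedge \mathrm{pr}_1^* \exists \varphi \le \bot \le \varphi$ and finally
  $\mathrm{pr}_1^* c \le \bot$. Thus the axiom can be dropped over the same list $\bar Z$. It is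
  essential to keep the constant in $\bar Z$, since \<open>B\<close> may fail to be inhabited. Dropping all axioms
  gives $\top \le \bot$ in $P(\Pi \bar Z)$, against non-triviality of the fibers.\<close>

section \<open>Products of lists of sorts\<close>

lemma Ctx_iff: "xs \<in> Ctx C \<Lambda> \<longleftrightarrow> distinct xs \<and> set xs \<subseteq> Obj C \<times> Field \<Lambda>"
  by (simp add: Ctx_def)

lemma Ctx_Nil [simp]: "[] \<in> Ctx C \<Lambda>"
  by (simp add: Ctx_def)

lemma Ctx_snoc: "xs @ [e] \<in> Ctx C \<Lambda> \<longleftrightarrow> xs \<in> Ctx C \<Lambda> \<and> e \<in> Obj C \<times> Field \<Lambda> \<and> e \<notin> set xs"
  by (auto simp: Ctx_def)

text \<open>Directedness of the index preorder. The entries of \<open>zs\<close> come in no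
  prescribed order; the preorder sees only the set of entries.\<close>

lemma Ctx_Un_ex:
  assumes "xs \<in> Ctx C \<Lambda>" and "ys \<in> Ctx C \<Lambda>"
  obtains zs where "zs \<in> Ctx C \<Lambda>" "set zs = set xs \<union> set ys"
proof -
  obtain zs where "set zs = set xs \<union> set ys" "distinct zs"
    using finite_distinct_list[of "set xs \<union> set ys"] by auto
  with assms show ?thesis
    using that by (auto simp: Ctx_def)
qed

lemma LPrd_Nil [simp]: "LPrd C [] = Trm C"
  and LPrd_snoc [simp]: "LPrd C (xs @ [e]) = LPrd C xs \<boxtimes>\<^bsub>C\<^esub> fst e"
  by (simp_all add: LPrd_def)

lemma entry_proj_snoc:
  "entry_proj C (xs @ [a]) e = (if a = e then Pr2 C (LPrd C xs) (fst a)
     else entry_proj C xs e \<cdot>\<^bsub>C\<^esub> Pr1 C (LPrd C xs) (fst a))"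
  by (simp add: entry_proj_def)

section \<open>Pairings and products with a fixed object\<close>

context fp_category
begin

lemma hom_obj:
  assumes "f \<in> Hom C A B"
  shows "A \<in> Obj C" and "B \<in> Obj C"
  using assms dom_obj cod_obj by (auto simp: Hom_def)

lemma hom_dom: "f \<in> Hom C A B \<Longrightarrow> Dom C f = A"
  and hom_cod: "f \<in> Hom C A B \<Longrightarrow> Cod C f = B"
  by (auto simp: Hom_def)

lemma trm_eqI: "\<lbrakk>f \<in> Hom C A (Trm C); g \<in> Hom C A (Trm C)\<rbrakk> \<Longrightarrow> f = g"
  using trm_univ hom_obj(1) by blast

lemma prd_eqI:
  assumes "A \<in> Obj C" "B \<in> Obj C" "h \<in> Hom C D (A \<boxtimes> B)" "k \<in> Hom C D (A \<boxtimes> B)"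
    and "Pr1 C A B \<cdot> h = Pr1 C A B \<cdot> k" "Pr2 C A B \<cdot> h = Pr2 C A B \<cdot> k"
  shows "h = k"
  using prd_univ[OF assms(1,2) comp_hom[OF assms(4) pr1_hom] comp_hom[OF assms(4) pr2_hom]] assms
  by blast

lemma
  assumes "f \<in> Hom C D A" "g \<in> Hom C D B"
  shows pair_hom: "pair C f g \<in> Hom C D (A \<boxtimes> B)"
    and pr1_pair: "Pr1 C A B \<cdot> pair C f g = f"
    and pr2_pair: "Pr2 C A B \<cdot> pair C f g = g"
proof -
  have "\<exists>!h. h \<in> Hom C D (A \<boxtimes> B) \<and> Pr1 C A B \<cdot> h = f \<and> Pr2 C A B \<cdot> h = g"
    using prd_univ assms hom_obj by blast
  from theI'[OF this] assms
  show "pair C f g \<in> Hom C D (A \<boxtimes> B)" "Pr1 C A B \<cdot> pair C f g = f" "Pr2 C A B \<cdot> pair C f g = g"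
    by (auto simp: pair_def hom_dom hom_cod)
qed

lemma
  assumes "f \<in> Hom C D E" "A \<in> Obj C"
  shows times_id_hom: "times_id C f A \<in> Hom C (D \<boxtimes> A) (E \<boxtimes> A)"
    and pr1_times_id: "Pr1 C E A \<cdot> times_id C f A = f \<cdot> Pr1 C D A"
    and pr2_times_id: "Pr2 C E A \<cdot> times_id C f A = Pr2 C D A"
proof -
  have "f \<cdot> Pr1 C D A \<in> Hom C (D \<boxtimes> A) E" "Pr2 C D A \<in> Hom C (D \<boxtimes> A) A"
    using assms hom_obj comp_hom pr1_hom pr2_hom by blast+
  with assms show "times_id C f A \<in> Hom C (D \<boxtimes> A) (E \<boxtimes> A)"
    "Pr1 C E A \<cdot> times_id C f A = f \<cdot> Pr1 C D A" "Pr2 C E A \<cdot> times_id C f A = Pr2 C D A"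
    by (auto simp: times_id_def hom_dom pair_hom pr1_pair pr2_pair)
qed

lemma times_id_ide:
  assumes "D \<in> Obj C" "A \<in> Obj C"
  shows "times_id C (Ide C D) A = Ide C (D \<boxtimes> A)"
proof (rule prd_eqI[OF assms])
  show "times_id C (Ide C D) A \<in> Hom C (D \<boxtimes> A) (D \<boxtimes> A)" "Ide C (D \<boxtimes> A) \<in> Hom C (D \<boxtimes> A) (D \<boxtimes> A)"
    using assms ide_hom times_id_hom prd_obj by blast+
  show "Pr1 C D A \<cdot> times_id C (Ide C D) A = Pr1 C D A \<cdot> Ide C (D \<boxtimes> A)"
    using pr1_times_id[OF ide_hom] comp_ide[OF pr1_hom] ide_comp[OF pr1_hom] assms by simp
  show "Pr2 C D A \<cdot> times_id C (Ide C D) A = Pr2 C D A \<cdot> Ide C (D \<boxtimes> A)"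
    using pr2_times_id[OF ide_hom] comp_ide[OF pr2_hom] assms by simp
qed

lemma times_id_comp:
  assumes f: "f \<in> Hom C D E" and g: "g \<in> Hom C E F" and A: "A \<in> Obj C"
  shows "times_id C (g \<cdot> f) A = times_id C g A \<cdot> times_id C f A"
proof (rule prd_eqI[OF _ A])
  note obj = hom_obj[OF f] hom_obj[OF g]
  note tf = times_id_hom[OF f A] and tg = times_id_hom[OF g A]
  note pr = pr1_hom[OF obj(1) A] pr1_hom[OF obj(2) A] pr1_hom[OF obj(4) A] pr2_hom[OF obj(4) A]
  show "F \<in> Obj C" by (rule obj(4))
  show "times_id C (g \<cdot> f) A \<in> Hom C (D \<boxtimes> A) (F \<boxtimes> A)"
    by (rule times_id_hom[OF comp_hom[OF f g] A])
  show "times_id C g A \<cdot> times_id C f A \<in> Hom C (D \<boxtimes> A) (F \<boxtimes> A)"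
    by (rule comp_hom[OF tf tg])
  have "Pr1 C F A \<cdot> times_id C (g \<cdot> f) A = g \<cdot> (f \<cdot> Pr1 C D A)"
    by (simp add: pr1_times_id[OF comp_hom[OF f g] A] comp_assoc[OF pr(1) f g])
  also have "\<dots> = (g \<cdot> Pr1 C E A) \<cdot> times_id C f A"
    by (simp add: pr1_times_id[OF f A, symmetric] comp_assoc[OF tf pr(2) g])
  also have "\<dots> = Pr1 C F A \<cdot> (times_id C g A \<cdot> times_id C f A)"
    by (simp add: pr1_times_id[OF g A, symmetric] comp_assoc[OF tf tg pr(3)])
  finally show "Pr1 C F A \<cdot> times_id C (g \<cdot> f) A = Pr1 C F A \<cdot> (times_id C g A \<cdot> times_id C f A)" .
  show "Pr2 C F A \<cdot> times_id C (g \<cdot> f) A = Pr2 C F A \<cdot> (times_id C g A \<cdot> times_id C f A)"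
    by (simp add: comp_assoc[OF tf tg pr(4), symmetric]
        pr2_times_id[OF comp_hom[OF f g] A] pr2_times_id[OF f A] pr2_times_id[OF g A])
qed

section \<open>Universal property of products of lists\<close>

lemma LPrd_obj: "xs \<in> Ctx C \<Lambda> \<Longrightarrow> LPrd C xs \<in> Obj C"
  by (induction xs rule: rev_induct) (auto simp: trm_obj Ctx_snoc intro!: prd_obj)

lemma entry_proj_hom: "\<lbrakk>xs \<in> Ctx C \<Lambda>; e \<in> set xs\<rbrakk> \<Longrightarrow> entry_proj C xs e \<in> Hom C (LPrd C xs) (fst e)"
proof (induction xs rule: rev_induct)
  case (snoc a xs)
  then have "xs \<in> Ctx C \<Lambda>" "fst a \<in> Obj C" "LPrd C xs \<in> Obj C"
    by (auto simp: Ctx_snoc LPrd_obj)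
  with snoc show ?case
    by (auto simp: entry_proj_snoc intro: pr2_hom comp_hom[OF pr1_hom])
qed simp

text \<open>The entry projections are jointly monic. Induction runs from the right end because
  products are bracketed to the left; distinctness of entries ensures that the projections of the
  shorter list factor through \<open>Pr1\<close> and are not shadowed by the last entry.\<close>

lemma LPrd_eqI:
  assumes "xs \<in> Ctx C \<Lambda>" "h \<in> Hom C D (LPrd C xs)" "k \<in> Hom C D (LPrd C xs)"
    and "\<And>e. e \<in> set xs \<Longrightarrow> entry_proj C xs e \<cdot> h = entry_proj C xs e \<cdot> k"
  shows "h = k"
  using assms
proof (induction xs arbitrary: h k rule: rev_induct)
  case Nil
  then show ?case by (simp add: trm_eqI)
next
  case (snoc a xs)
  then have xs: "xs \<in> Ctx C \<Lambda>" and a: "fst a \<in> Obj C" "a \<notin> set xs"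
    by (auto simp: Ctx_snoc)
  note A = LPrd_obj[OF xs]
  note p1 = pr1_hom[OF A a(1)]
  have hk: "h \<in> Hom C D (LPrd C xs \<boxtimes> fst a)" "k \<in> Hom C D (LPrd C xs \<boxtimes> fst a)"
    using snoc.prems by simp_all
  have "Pr1 C (LPrd C xs) (fst a) \<cdot> h = Pr1 C (LPrd C xs) (fst a) \<cdot> k"
  proof (rule snoc.IH[OF xs comp_hom[OF hk(1) p1] comp_hom[OF hk(2) p1]])
    fix e assume e: "e \<in> set xs"
    then have "a \<noteq> e" using a by blast
    with snoc.prems(4)[of e] e
    show "entry_proj C xs e \<cdot> (Pr1 C (LPrd C xs) (fst a) \<cdot> h)
        = entry_proj C xs e \<cdot> (Pr1 C (LPrd C xs) (fst a) \<cdot> k)"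
      by (simp add: entry_proj_snoc comp_assoc[OF hk(1) p1 entry_proj_hom[OF xs e]]
          comp_assoc[OF hk(2) p1 entry_proj_hom[OF xs e]])
  qed
  moreover have "Pr2 C (LPrd C xs) (fst a) \<cdot> h = Pr2 C (LPrd C xs) (fst a) \<cdot> k"
    using snoc.prems(4)[of a] by (simp add: entry_proj_snoc)
  ultimately show ?case
    using prd_eqI[OF A a(1) hk] by blast
qed

text \<open>Existence half of the universal property: the tuple is built by pairing the tuple for
  the shorter list with the component at the last entry, starting from the map into the terminal
  object.\<close>

lemma LPrd_ex:
  assumes "xs \<in> Ctx C \<Lambda>" "D \<in> Obj C" and "\<And>e. e \<in> set xs \<Longrightarrow> g e \<in> Hom C D (fst e)"
  shows "\<exists>h. h \<in> Hom C D (LPrd C xs) \<and> (\<forall>e\<in>set xs. entry_proj C xs e \<cdot> h = g e)"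
  using assms
proof (induction xs rule: rev_induct)
  case Nil
  show ?case using trm_univ[OF Nil.prems(2)] by auto
next
  case (snoc a xs)
  then have xs: "xs \<in> Ctx C \<Lambda>" and a: "fst a \<in> Obj C" "a \<notin> set xs"
    by (auto simp: Ctx_snoc)
  note A = LPrd_obj[OF xs]
  note p1 = pr1_hom[OF A a(1)]
  obtain h where h: "h \<in> Hom C D (LPrd C xs)" "\<forall>e\<in>set xs. entry_proj C xs e \<cdot> h = g e"
    using snoc.IH[OF xs snoc.prems(2)] snoc.prems(3) by auto
  have ga: "g a \<in> Hom C D (fst a)"
    using snoc.prems(3) by simp
  note k = pair_hom[OF h(1) ga]
  have "entry_proj C (xs @ [a]) e \<cdot> pair C h (g a) = g e" if "e \<in> set (xs @ [a])" for e
  proof (cases "a = e")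
    case True
    then show ?thesis using pr2_pair[OF h(1) ga] by (simp add: entry_proj_snoc)
  next
    case False
    with that have "e \<in> set xs" by auto
    with False h(2) show ?thesis
      by (simp add: entry_proj_snoc comp_assoc[OF k p1 entry_proj_hom[OF xs]] pr1_pair[OF h(1) ga])
  qed
  with k show ?case unfolding LPrd_snoc by blast
qed

section \<open>Projections between products of lists\<close>

lemma ctx_proj_eqI:
  assumes "xs \<in> Ctx C \<Lambda>" "h \<in> Hom C (LPrd C zs) (LPrd C xs)"
    and "\<And>e. e \<in> set xs \<Longrightarrow> entry_proj C xs e \<cdot> h = entry_proj C zs e"
  shows "ctx_proj C zs xs = h"
  unfolding ctx_proj_def using assms LPrd_eqI[OF assms(1)] by (intro the_equality) auto

text \<open>\<open>LPrd_ex\<close> with the family of entry projections of \<open>zs\<close>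
  provides a candidate, and \<open>ctx_proj_eqI\<close> identifies it with the definite description
  \<open>ctx_proj\<close>.\<close>

lemma
  assumes "xs \<in> Ctx C \<Lambda>" "zs \<in> Ctx C \<Lambda>" "set xs \<subseteq> set zs"
  shows ctx_proj_hom: "ctx_proj C zs xs \<in> Hom C (LPrd C zs) (LPrd C xs)"
    and entry_proj_ctx_proj:
      "e \<in> set xs \<Longrightarrow> entry_proj C xs e \<cdot> ctx_proj C zs xs = entry_proj C zs e"
proof -
  obtain h where h: "h \<in> Hom C (LPrd C zs) (LPrd C xs)"
    "\<And>e. e \<in> set xs \<Longrightarrow> entry_proj C xs e \<cdot> h = entry_proj C zs e"
    using LPrd_ex[OF assms(1) LPrd_obj[OF assms(2)], of "entry_proj C zs"]
      entry_proj_hom[OF assms(2)] assms(3) by blast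
  with ctx_proj_eqI[OF assms(1)]
  show "ctx_proj C zs xs \<in> Hom C (LPrd C zs) (LPrd C xs)"
    "e \<in> set xs \<Longrightarrow> entry_proj C xs e \<cdot> ctx_proj C zs xs = entry_proj C zs e"
    by simp_all
qed

lemma ctx_proj_same: "xs \<in> Ctx C \<Lambda> \<Longrightarrow> ctx_proj C xs xs = Ide C (LPrd C xs)"
  by (rule ctx_proj_eqI) (auto intro: ide_hom LPrd_obj comp_ide entry_proj_hom)

lemma ctx_proj_comp:
  assumes xs: "xs \<in> Ctx C \<Lambda>" and ys: "ys \<in> Ctx C \<Lambda>" and zs: "zs \<in> Ctx C \<Lambda>"
    and "set xs \<subseteq> set ys" "set ys \<subseteq> set zs"
  shows "ctx_proj C ys xs \<cdot> ctx_proj C zs ys = ctx_proj C zs xs"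
proof (rule ctx_proj_eqI[OF xs, symmetric])
  note h = ctx_proj_hom[OF ys zs assms(5)] ctx_proj_hom[OF xs ys assms(4)]
  show "ctx_proj C ys xs \<cdot> ctx_proj C zs ys \<in> Hom C (LPrd C zs) (LPrd C xs)"
    by (rule comp_hom[OF h])
  fix e assume e: "e \<in> set xs"
  with assms(4) have "e \<in> set ys" by blast
  with e show "entry_proj C xs e \<cdot> (ctx_proj C ys xs \<cdot> ctx_proj C zs ys) = entry_proj C zs e"
    by (simp add: comp_assoc[OF h entry_proj_hom[OF xs e], symmetric]
        entry_proj_ctx_proj[OF xs ys assms(4)] entry_proj_ctx_proj[OF ys zs assms(5)])
qed

text \<open>Forgetting the last constant is a product projection, the map along which the
  existential quantifier is a left adjoint.\<close>

lemma ctx_proj_snoc: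
  assumes "xs @ [e] \<in> Ctx C \<Lambda>"
  shows "ctx_proj C (xs @ [e]) xs = Pr1 C (LPrd C xs) (fst e)"
  using assms
  by (intro ctx_proj_eqI) (auto simp: Ctx_snoc entry_proj_snoc intro: pr1_hom LPrd_obj)

text \<open>This is the shape of arrow for which Beck-Chevalley is stated; it lets weakening pass
  through the quantifier in a Henkin axiom.\<close>

lemma ctx_proj_snoc_snoc:
  assumes xs: "xs @ [e] \<in> Ctx C \<Lambda>" and zs: "zs @ [e] \<in> Ctx C \<Lambda>" and sub: "set xs \<subseteq> set zs"
  shows "ctx_proj C (zs @ [e]) (xs @ [e]) = times_id C (ctx_proj C zs xs) (fst e)"
proof (rule ctx_proj_eqI[OF xs])
  have xs': "xs \<in> Ctx C \<Lambda>" and zs': "zs \<in> Ctx C \<Lambda>" and e: "fst e \<in> Obj C" "e \<notin> set xs" "e \<notin> set zs"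
    using xs zs by (auto simp: Ctx_snoc)
  note p = ctx_proj_hom[OF xs' zs' sub]
  note t = times_id_hom[OF p e(1)]
  note pr = pr1_hom[OF LPrd_obj[OF xs'] e(1)] pr1_hom[OF LPrd_obj[OF zs'] e(1)]
  show "times_id C (ctx_proj C zs xs) (fst e) \<in> Hom C (LPrd C (zs @ [e])) (LPrd C (xs @ [e]))"
    using t by simp
  fix a assume a: "a \<in> set (xs @ [e])"
  show "entry_proj C (xs @ [e]) a \<cdot> times_id C (ctx_proj C zs xs) (fst e) = entry_proj C (zs @ [e]) a"
  proof (cases "e = a")
    case True
    then show ?thesis using pr2_times_id[OF p e(1)] by (simp add: entry_proj_snoc)
  next
    case False
    with a have a': "a \<in> set xs" by auto
    note q = entry_proj_hom[OF xs' a']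
    show ?thesis
      using False by (simp add: entry_proj_snoc comp_assoc[OF t pr(1) q] pr1_times_id[OF p e(1)]
          comp_assoc[OF pr(2) p q, symmetric] entry_proj_ctx_proj[OF xs' zs' sub a'])
  qed
qed

section \<open>Weakening of constants and the terminal arrow\<close>

lemma wk_hom:
  assumes "xs \<in> Ctx C \<Lambda>" "zs \<in> Ctx C \<Lambda>" "set xs \<subseteq> set zs" "A \<in> Obj C"
  shows "wk C zs xs A \<in> Hom C (LPrd C zs \<boxtimes> A) (LPrd C xs \<boxtimes> A)"
  using assms by (intro times_id_hom ctx_proj_hom)

lemma wk_comp:
  assumes "xs \<in> Ctx C \<Lambda>" "ys \<in> Ctx C \<Lambda>" "zs \<in> Ctx C \<Lambda>"
    and "set xs \<subseteq> set ys" "set ys \<subseteq> set zs" "A \<in> Obj C"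
  shows "wk C ys xs A \<cdot> wk C zs ys A = wk C zs xs A"
  using times_id_comp[OF ctx_proj_hom ctx_proj_hom, of ys \<Lambda> zs xs \<Lambda> A] ctx_proj_comp assms by metis

lemma wk_same: "\<lbrakk>xs \<in> Ctx C \<Lambda>; A \<in> Obj C\<rbrakk> \<Longrightarrow> wk C xs xs A = Ide C (LPrd C xs \<boxtimes> A)"
  using ctx_proj_same times_id_ide LPrd_obj by metis

text \<open>A map into the terminal object must be the second projection, and pairing the two
  projections gives the identity.\<close>

lemma graph_trm:
  assumes "zs \<in> Ctx C \<Lambda>" "f \<in> Hom C (LPrd C zs \<boxtimes> Trm C) (Trm C)"
  shows "graph C zs f (Trm C) = Ide C (LPrd C zs \<boxtimes> Trm C)"
proof -
  note A = LPrd_obj[OF assms(1)]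
  note p1 = pr1_hom[OF A trm_obj] and p2 = pr2_hom[OF A trm_obj]
  have "f = Pr2 C (LPrd C zs) (Trm C)"
    using assms(2) p2 by (rule trm_eqI)
  moreover note i = ide_hom[OF prd_obj[OF A trm_obj]]
  ultimately show ?thesis
    unfolding graph_def
    using prd_eqI[OF A trm_obj pair_hom[OF p1 p2] i] pr1_pair[OF p1 p2] pr2_pair[OF p1 p2]
      comp_ide[OF p1] comp_ide[OF p2] by simp
qed

text \<open>Over a common list any two representatives become maps into the terminal object and
  therefore agree. Hence there is a single class, consisting of all representatives.\<close>

lemma bang_const_cat_trm:
  "bang (const_cat C \<Lambda>) (Trm C) = (Trm C, Trm C, arr_reps C \<Lambda> (Trm C) (Trm C))"
proof -
  let ?T = "Trm C" and ?R = "arr_reps C \<Lambda> (Trm C) (Trm C)"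
  have "arr_rel C \<Lambda> ?T ?T = ?R \<times> ?R"
  proof -
    have "\<exists>zs\<in>Ctx C \<Lambda>. set xs \<subseteq> set zs \<and> set ys \<subseteq> set zs \<and> f \<cdot> wk C zs xs ?T = g \<cdot> wk C zs ys ?T"
      if fx: "xs \<in> Ctx C \<Lambda>" "f \<in> Hom C (LPrd C xs \<boxtimes> ?T) ?T"
        and gy: "ys \<in> Ctx C \<Lambda>" "g \<in> Hom C (LPrd C ys \<boxtimes> ?T) ?T" for f xs g ys
    proof -
      obtain zs where zs: "zs \<in> Ctx C \<Lambda>" "set zs = set xs \<union> set ys"
        using Ctx_Un_ex[OF fx(1) gy(1)] .
      then have "f \<cdot> wk C zs xs ?T = g \<cdot> wk C zs ys ?T"
        using fx gy by (intro trm_eqI[of _ "LPrd C zs \<boxtimes> ?T"] comp_hom[OF wk_hom] trm_obj) auto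
      with zs show ?thesis by blast
    qed
    then show ?thesis
      unfolding arr_rel_def arr_reps_def by auto
  qed
  moreover have "(Pr2 C ?T ?T, []) \<in> ?R"
    using pr2_hom[OF trm_obj trm_obj] by (simp add: arr_reps_def)
  ultimately have "?R // arr_rel C \<Lambda> ?T ?T = {?R}"
    by (auto simp: quotient_def)
  then have "Hom (const_cat C \<Lambda>) ?T ?T = {(?T, ?T, ?R)}"
    by (auto simp: Hom_def const_cat_def trm_obj)
  then show ?thesis
    by (simp add: bang_def const_cat_def)
qed

end

section \<open>The fibers of the doctrine with constants\<close>

text \<open>For the empty set the lower bounds are the whole carrier, so the infimum is the top
  element. This case is the conjunction of no axioms.\<close>

lemma (in lower_semilattice) finite_inf_greatest_top:
  assumes "\<exists>t. greatest L t (carrier L)" and "finite A" "A \<subseteq> carrier L"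
  shows "greatest L (\<Sqinter>A) (Lower L A)"
proof (cases "A = {}")
  case True
  then show ?thesis
    using someI_ex[OF assms(1)] by (simp add: Lattice.inf_def)
next
  case False
  with assms show ?thesis
    by (simp add: finite_inf_greatest)
qed

section \<open>Equality and order of formulas with constants\<close>

context doctrine
begin

abbreviation fib_le (\<open>(_/ \<preceq>\<^bsub>_\<^esub> _)\<close> [51, 0, 51] 50) where
  "x \<preceq>\<^bsub>A\<^esub> y \<equiv> x \<sqsubseteq>\<^bsub>Fib P A\<^esub> y"

lemma fib_refl: "\<lbrakk>A \<in> Obj (Base P); x \<in> carrier (Fib P A)\<rbrakk> \<Longrightarrow> x \<preceq>\<^bsub>A\<^esub> x"
  using fib_poset by (simp add: partial_order_def weak_partial_order.le_refl)

lemma fib_trans: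
  "\<lbrakk>x \<preceq>\<^bsub>A\<^esub> y; y \<preceq>\<^bsub>A\<^esub> z; A \<in> Obj (Base P); x \<in> carrier (Fib P A); y \<in> carrier (Fib P A);
    z \<in> carrier (Fib P A)\<rbrakk> \<Longrightarrow> x \<preceq>\<^bsub>A\<^esub> z"
  using fib_poset by (meson partial_order_def weak_partial_order.le_trans)

lemma fib_antisym:
  "\<lbrakk>x \<preceq>\<^bsub>A\<^esub> y; y \<preceq>\<^bsub>A\<^esub> x; A \<in> Obj (Base P); x \<in> carrier (Fib P A); y \<in> carrier (Fib P A)\<rbrakk> \<Longrightarrow> x = y"
  using fib_poset partial_order.le_antisym by metis

lemma rx_in: "\<lbrakk>f \<in> Hom (Base P) A B; x \<in> carrier (Fib P B)\<rbrakk> \<Longrightarrow> Rx P f x \<in> carrier (Fib P A)"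
  using rx_closed by blast

lemma rx_le:
  "\<lbrakk>f \<in> Hom (Base P) A B; x \<preceq>\<^bsub>B\<^esub> y; x \<in> carrier (Fib P B); y \<in> carrier (Fib P B)\<rbrakk>
    \<Longrightarrow> Rx P f x \<preceq>\<^bsub>A\<^esub> Rx P f y"
  using rx_mono use_iso2 by metis

lemma form_reps_iff:
  "(\<alpha>, xs) \<in> form_reps P \<Lambda> A \<longleftrightarrow>
    xs \<in> Ctx (Base P) \<Lambda> \<and> \<alpha> \<in> carrier (Fib P (LPrd (Base P) xs \<boxtimes>\<^bsub>Base P\<^esub> A))"
  by (simp add: form_reps_def)

lemma rx_wk_in:
  assumes "(\<alpha>, xs) \<in> form_reps P \<Lambda> A" "zs \<in> Ctx (Base P) \<Lambda>" "set xs \<subseteq> set zs" "A \<in> Obj (Base P)"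
  shows "Rx P (wk (Base P) zs xs A) \<alpha> \<in> carrier (Fib P (LPrd (Base P) zs \<boxtimes>\<^bsub>Base P\<^esub> A))"
  using assms by (auto simp: form_reps_iff intro: rx_in wk_hom)

lemma rx_wk_rx_wk:
  assumes "(\<alpha>, xs) \<in> form_reps P \<Lambda> A" "ys \<in> Ctx (Base P) \<Lambda>" "zs \<in> Ctx (Base P) \<Lambda>"
    and "set xs \<subseteq> set ys" "set ys \<subseteq> set zs" "A \<in> Obj (Base P)"
  shows "Rx P (wk (Base P) zs ys A) (Rx P (wk (Base P) ys xs A) \<alpha>) = Rx P (wk (Base P) zs xs A) \<alpha>"
  using assms rx_comp[OF wk_hom wk_hom, of ys \<Lambda> zs A xs \<Lambda> \<alpha>] wk_comp[of xs \<Lambda> ys zs A]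
  by (simp add: form_reps_iff)

lemma rx_wk_same:
  assumes "(\<alpha>, xs) \<in> form_reps P \<Lambda> A" "A \<in> Obj (Base P)"
  shows "Rx P (wk (Base P) xs xs A) \<alpha> = \<alpha>"
proof -
  have "xs \<in> Ctx (Base P) \<Lambda>" using assms by (simp add: form_reps_iff)
  then show ?thesis
    using assms wk_same[of xs \<Lambda> A] rx_ide[OF prd_obj[OF LPrd_obj], of xs \<Lambda> A \<alpha>]
    by (simp add: form_reps_iff)
qed

text \<open>Reindexing is monotone and successive weakenings compose, so an inequality witnessed
  over one list persists over every larger list.\<close>

lemma rx_wk_le_mono:
  assumes "Rx P (wk (Base P) zs xs A) \<alpha> \<preceq>\<^bsub>LPrd (Base P) zs \<boxtimes>\<^bsub>Base P\<^esub> A\<^esub> Rx P (wk (Base P) zs ys A) \<beta>"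
    and "(\<alpha>, xs) \<in> form_reps P \<Lambda> A" "(\<beta>, ys) \<in> form_reps P \<Lambda> A"
    and "set xs \<subseteq> set zs" "set ys \<subseteq> set zs" "set zs \<subseteq> set vs"
    and "zs \<in> Ctx (Base P) \<Lambda>" "vs \<in> Ctx (Base P) \<Lambda>" "A \<in> Obj (Base P)"
  shows "Rx P (wk (Base P) vs xs A) \<alpha> \<preceq>\<^bsub>LPrd (Base P) vs \<boxtimes>\<^bsub>Base P\<^esub> A\<^esub> Rx P (wk (Base P) vs ys A) \<beta>"
  using rx_le[OF wk_hom[OF assms(7,8,6,9)] assms(1)
      rx_wk_in[OF assms(2,7,4,9)] rx_wk_in[OF assms(3,7,5,9)]]
  unfolding rx_wk_rx_wk[OF assms(2,7,8,4,6,9)] rx_wk_rx_wk[OF assms(3,7,8,5,6,9)] .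

lemma form_rel_iff:
  "((\<alpha>, xs), (\<beta>, ys)) \<in> form_rel P \<Lambda> A \<longleftrightarrow> (\<alpha>, xs) \<in> form_reps P \<Lambda> A \<and> (\<beta>, ys) \<in> form_reps P \<Lambda> A \<and>
     (\<exists>zs\<in>Ctx (Base P) \<Lambda>. set xs \<subseteq> set zs \<and> set ys \<subseteq> set zs \<and>
        Rx P (wk (Base P) zs xs A) \<alpha> = Rx P (wk (Base P) zs ys A) \<beta>)"
  by (simp add: form_rel_def)

lemma form_rel_equiv:
  assumes A: "A \<in> Obj (Base P)"
  shows "equiv (form_reps P \<Lambda> A) (form_rel P \<Lambda> A)"
proof (rule equivI)
  show "form_rel P \<Lambda> A \<subseteq> form_reps P \<Lambda> A \<times> form_reps P \<Lambda> A"
    by (auto simp: form_rel_def)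
  show "refl_on (form_reps P \<Lambda> A) (form_rel P \<Lambda> A)"
    by (rule refl_onI) (auto simp: form_rel_iff form_reps_iff)
  show "sym (form_rel P \<Lambda> A)"
    by (rule symI) (auto simp: form_rel_def eq_commute)
  show "trans (form_rel P \<Lambda> A)"
  proof (rule transI, clarsimp simp only: split_paired_all)
    fix \<alpha> xs \<beta> ys \<gamma> us
    assume "((\<alpha>, xs), (\<beta>, ys)) \<in> form_rel P \<Lambda> A" "((\<beta>, ys), (\<gamma>, us)) \<in> form_rel P \<Lambda> A"
    then obtain zs ws where reps: "(\<alpha>, xs) \<in> form_reps P \<Lambda> A" "(\<beta>, ys) \<in> form_reps P \<Lambda> A"
        "(\<gamma>, us) \<in> form_reps P \<Lambda> A"
      and zs: "zs \<in> Ctx (Base P) \<Lambda>" "set xs \<subseteq> set zs" "set ys \<subseteq> set zs"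
        "Rx P (wk (Base P) zs xs A) \<alpha> = Rx P (wk (Base P) zs ys A) \<beta>"
      and ws: "ws \<in> Ctx (Base P) \<Lambda>" "set ys \<subseteq> set ws" "set us \<subseteq> set ws"
        "Rx P (wk (Base P) ws ys A) \<beta> = Rx P (wk (Base P) ws us A) \<gamma>"
      unfolding form_rel_iff by blast
    \<comment> \<open>The two equalities are witnessed over different lists; both are carried to a
      list containing all entries, where they can be chained at \<open>\<beta>\<close>.\<close>
    obtain vs where vs: "vs \<in> Ctx (Base P) \<Lambda>" "set vs = set zs \<union> set ws"
      using Ctx_Un_ex[OF zs(1) ws(1)] .
    then have sub: "set zs \<subseteq> set vs" "set ws \<subseteq> set vs" by auto
    have "Rx P (wk (Base P) vs xs A) \<alpha> = Rx P (wk (Base P) vs us A) \<gamma>"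
      using rx_wk_rx_wk[OF reps(1) zs(1) vs(1) zs(2) sub(1) A] rx_wk_rx_wk[OF reps(2) zs(1) vs(1) zs(3) sub(1) A]
        rx_wk_rx_wk[OF reps(2) ws(1) vs(1) ws(2) sub(2) A] rx_wk_rx_wk[OF reps(3) ws(1) vs(1) ws(3) sub(2) A]
        zs(4) ws(4) by simp
    with reps vs sub zs(2) ws(3) show "((\<alpha>, xs), (\<gamma>, us)) \<in> form_rel P \<Lambda> A"
      unfolding form_rel_iff by blast
  qed
qed

text \<open>The larger list itself witnesses the equivalence. This permits moving several classes to
  one common list.\<close>

lemma form_cls_wk:
  assumes "(\<alpha>, xs) \<in> form_reps P \<Lambda> A" "zs \<in> Ctx (Base P) \<Lambda>" "set xs \<subseteq> set zs" "A \<in> Obj (Base P)"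
  shows "form_cls P \<Lambda> A (Rx P (wk (Base P) zs xs A) \<alpha>) zs = form_cls P \<Lambda> A \<alpha> xs"
proof -
  have "(Rx P (wk (Base P) zs xs A) \<alpha>, zs) \<in> form_reps P \<Lambda> A"
    using rx_wk_in[OF assms] assms(2) by (simp add: form_reps_iff)
  from this rx_wk_same[OF this assms(4)] have "((\<alpha>, xs), (Rx P (wk (Base P) zs xs A) \<alpha>, zs)) \<in> form_rel P \<Lambda> A"
    unfolding form_rel_iff using assms
    by (auto intro!: bexI[of _ zs])
  from equiv_class_eq[OF form_rel_equiv this] assms(4) show ?thesis
    by (simp add: form_cls_def)
qed

text \<open>The relation \<open>form_le\<close> mentions some representatives and some list.
  Persistence under weakening turns this into a statement about the given representatives that holds
  over all sufficiently large lists, so finitely many such inequalities can be used together over a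
  union of their lists.\<close>

lemma form_le_cls:
  assumes \<alpha>: "(\<alpha>, xs) \<in> form_reps P \<Lambda> A" and \<beta>: "(\<beta>, ys) \<in> form_reps P \<Lambda> A" and A: "A \<in> Obj (Base P)"
  shows "form_le P \<Lambda> A (form_cls P \<Lambda> A \<alpha> xs) (form_cls P \<Lambda> A \<beta> ys) \<longleftrightarrow>
    (\<exists>zs\<in>Ctx (Base P) \<Lambda>. set xs \<subseteq> set zs \<and> set ys \<subseteq> set zs \<and>
      (\<forall>vs\<in>Ctx (Base P) \<Lambda>. set zs \<subseteq> set vs \<longrightarrow>
        Rx P (wk (Base P) vs xs A) \<alpha> \<preceq>\<^bsub>LPrd (Base P) vs \<boxtimes>\<^bsub>Base P\<^esub> A\<^esub> Rx P (wk (Base P) vs ys A) \<beta>))"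
  (is "?l \<longleftrightarrow> ?r")
proof
  assume ?l
  then obtain \<alpha>' xs' \<beta>' ys' zs where
    rel: "((\<alpha>, xs), (\<alpha>', xs')) \<in> form_rel P \<Lambda> A" "((\<beta>, ys), (\<beta>', ys')) \<in> form_rel P \<Lambda> A"
    and zs: "zs \<in> Ctx (Base P) \<Lambda>" "set xs' \<subseteq> set zs" "set ys' \<subseteq> set zs"
    and le: "Rx P (wk (Base P) zs xs' A) \<alpha>' \<preceq>\<^bsub>LPrd (Base P) zs \<boxtimes>\<^bsub>Base P\<^esub> A\<^esub> Rx P (wk (Base P) zs ys' A) \<beta>'"
    unfolding form_le_def form_cls_def by blast
  from rel obtain us ws where reps: "(\<alpha>', xs') \<in> form_reps P \<Lambda> A" "(\<beta>', ys') \<in> form_reps P \<Lambda> A"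
    and us: "us \<in> Ctx (Base P) \<Lambda>" "set xs \<subseteq> set us" "set xs' \<subseteq> set us"
      "Rx P (wk (Base P) us xs A) \<alpha> = Rx P (wk (Base P) us xs' A) \<alpha>'"
    and ws: "ws \<in> Ctx (Base P) \<Lambda>" "set ys \<subseteq> set ws" "set ys' \<subseteq> set ws"
      "Rx P (wk (Base P) ws ys A) \<beta> = Rx P (wk (Base P) ws ys' A) \<beta>'"
    unfolding form_rel_iff by blast
  obtain ts where ts: "ts \<in> Ctx (Base P) \<Lambda>" "set ts = set us \<union> set ws"
    using Ctx_Un_ex[OF us(1) ws(1)] .
  \<comment> \<open>Beyond \<open>rs\<close> the inequality between the chosen representatives
    holds, and these already coincide with \<open>\<alpha>\<close> and
    \<open>\<beta>\<close>.\<close>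
  obtain rs where rs: "rs \<in> Ctx (Base P) \<Lambda>" "set rs = set zs \<union> set ts"
    using Ctx_Un_ex[OF zs(1) ts(1)] .
  have "Rx P (wk (Base P) vs xs A) \<alpha> \<preceq>\<^bsub>LPrd (Base P) vs \<boxtimes>\<^bsub>Base P\<^esub> A\<^esub> Rx P (wk (Base P) vs ys A) \<beta>"
    if vs: "vs \<in> Ctx (Base P) \<Lambda>" "set rs \<subseteq> set vs" for vs
  proof -
    have sub: "set zs \<subseteq> set vs" "set us \<subseteq> set vs" "set ws \<subseteq> set vs"
      using vs rs ts by auto
    show ?thesis
      using rx_wk_le_mono[OF le reps zs(2,3) sub(1) zs(1) vs(1) A]
        rx_wk_rx_wk[OF \<alpha> us(1) vs(1) us(2) sub(2) A] rx_wk_rx_wk[OF reps(1) us(1) vs(1) us(3) sub(2) A]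
        rx_wk_rx_wk[OF \<beta> ws(1) vs(1) ws(2) sub(3) A] rx_wk_rx_wk[OF reps(2) ws(1) vs(1) ws(3) sub(3) A]
        us(4) ws(4) by simp
  qed
  moreover have "set xs \<subseteq> set rs" "set ys \<subseteq> set rs"
    using rs ts us(2) ws(2) by auto
  ultimately show ?r using rs(1) by blast
next
  assume ?r
  moreover have "(\<alpha>, xs) \<in> form_cls P \<Lambda> A \<alpha> xs" "(\<beta>, ys) \<in> form_cls P \<Lambda> A \<beta> ys"
    using equiv_class_self[OF form_rel_equiv[OF A]] \<alpha> \<beta> by (auto simp: form_cls_def)
  ultimately show ?l
    unfolding form_le_def by blast
qed

lemma form_le_clsE:
  assumes "form_le P \<Lambda> A (form_cls P \<Lambda> A \<alpha> xs) (form_cls P \<Lambda> A \<beta> ys)"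
    and "(\<alpha>, xs) \<in> form_reps P \<Lambda> A" "(\<beta>, ys) \<in> form_reps P \<Lambda> A" "A \<in> Obj (Base P)"
  obtains zs where "zs \<in> Ctx (Base P) \<Lambda>" "set xs \<subseteq> set zs" "set ys \<subseteq> set zs"
    "\<forall>vs\<in>Ctx (Base P) \<Lambda>. set zs \<subseteq> set vs \<longrightarrow>
        Rx P (wk (Base P) vs xs A) \<alpha> \<preceq>\<^bsub>LPrd (Base P) vs \<boxtimes>\<^bsub>Base P\<^esub> A\<^esub> Rx P (wk (Base P) vs ys A) \<beta>"
  using assms(1) unfolding form_le_cls[OF assms(2-)] by blast

lemma form_le_clsI:
  assumes "(\<alpha>, zs) \<in> form_reps P \<Lambda> A" "(\<beta>, zs) \<in> form_reps P \<Lambda> A" "A \<in> Obj (Base P)"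
    and "\<alpha> \<preceq>\<^bsub>LPrd (Base P) zs \<boxtimes>\<^bsub>Base P\<^esub> A\<^esub> \<beta>"
  shows "form_le P \<Lambda> A (form_cls P \<Lambda> A \<alpha> zs) (form_cls P \<Lambda> A \<beta> zs)"
proof -
  have zs: "zs \<in> Ctx (Base P) \<Lambda>" using assms(1) by (simp add: form_reps_iff)
  have "Rx P (wk (Base P) vs zs A) \<alpha> \<preceq>\<^bsub>LPrd (Base P) vs \<boxtimes>\<^bsub>Base P\<^esub> A\<^esub> Rx P (wk (Base P) vs zs A) \<beta>"
    if "vs \<in> Ctx (Base P) \<Lambda>" "set zs \<subseteq> set vs" for vs
    using that assms rx_le[OF wk_hom[OF zs]] by (simp add: form_reps_iff)
  with zs show ?thesis
    unfolding form_le_cls[OF assms(1-3)] by blast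
qed

lemma
  shows carrier_const_fib: "carrier (Fib (const_doctrine P \<Lambda>) A) = form_reps P \<Lambda> A // form_rel P \<Lambda> A"
    and eq_const_fib: "eq (Fib (const_doctrine P \<Lambda>) A) = (=)"
    and le_const_fib: "le (Fib (const_doctrine P \<Lambda>) A) = form_le P \<Lambda> A"
  by (simp_all add: const_doctrine_def)

lemma form_cls_in:
  "(\<alpha>, xs) \<in> form_reps P \<Lambda> A \<Longrightarrow> form_cls P \<Lambda> A \<alpha> xs \<in> carrier (Fib (const_doctrine P \<Lambda>) A)"
  by (simp add: carrier_const_fib form_cls_def quotientI)

lemma const_fibE:
  assumes "k \<in> carrier (Fib (const_doctrine P \<Lambda>) A)"
  obtains \<alpha> xs where "(\<alpha>, xs) \<in> form_reps P \<Lambda> A" "k = form_cls P \<Lambda> A \<alpha> xs"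
  using assms by (auto simp: carrier_const_fib form_cls_def elim: quotientE)

section \<open>The fibers with constants are posets\<close>

lemma const_fib_poset:
  assumes A: "A \<in> Obj (Base P)"
  shows "partial_order (Fib (const_doctrine P \<Lambda>) A)"
proof -
  let ?L = "Fib (const_doctrine P \<Lambda>) A"
  have refl: "form_le P \<Lambda> A k k" if "k \<in> carrier ?L" for k
  proof -
    obtain \<alpha> xs where k: "(\<alpha>, xs) \<in> form_reps P \<Lambda> A" "k = form_cls P \<Lambda> A \<alpha> xs"
      using const_fibE[OF \<open>k \<in> carrier ?L\<close>] .
    then show ?thesis
      using form_le_clsI[OF k(1) k(1) A fib_refl[OF prd_obj[OF LPrd_obj A]]] by (auto simp: form_reps_iff)
  qed
  have antisym: "k = l" if le: "form_le P \<Lambda> A k l" "form_le P \<Lambda> A l k"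
    and kl: "k \<in> carrier ?L" "l \<in> carrier ?L" for k l
  proof -
    obtain \<alpha> xs where \<alpha>: "(\<alpha>, xs) \<in> form_reps P \<Lambda> A" and k: "k = form_cls P \<Lambda> A \<alpha> xs"
      using const_fibE[OF kl(1)] .
    obtain \<beta> ys where \<beta>: "(\<beta>, ys) \<in> form_reps P \<Lambda> A" and l: "l = form_cls P \<Lambda> A \<beta> ys"
      using const_fibE[OF kl(2)] .
    obtain us where us: "us \<in> Ctx (Base P) \<Lambda>" "set xs \<subseteq> set us" "set ys \<subseteq> set us"
        "\<forall>vs\<in>Ctx (Base P) \<Lambda>. set us \<subseteq> set vs \<longrightarrow>
          Rx P (wk (Base P) vs xs A) \<alpha> \<preceq>\<^bsub>LPrd (Base P) vs \<boxtimes>\<^bsub>Base P\<^esub> A\<^esub> Rx P (wk (Base P) vs ys A) \<beta>"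
      using form_le_clsE[OF le(1)[unfolded k l] \<alpha> \<beta> A] .
    obtain ws where ws: "ws \<in> Ctx (Base P) \<Lambda>" "set ys \<subseteq> set ws" "set xs \<subseteq> set ws"
        "\<forall>vs\<in>Ctx (Base P) \<Lambda>. set ws \<subseteq> set vs \<longrightarrow>
          Rx P (wk (Base P) vs ys A) \<beta> \<preceq>\<^bsub>LPrd (Base P) vs \<boxtimes>\<^bsub>Base P\<^esub> A\<^esub> Rx P (wk (Base P) vs xs A) \<alpha>"
      using form_le_clsE[OF le(2)[unfolded k l] \<beta> \<alpha> A] .
    obtain vs where vs: "vs \<in> Ctx (Base P) \<Lambda>" "set vs = set us \<union> set ws"
      using Ctx_Un_ex[OF us(1) ws(1)] .
    then have sub: "set us \<subseteq> set vs" "set ws \<subseteq> set vs" "set xs \<subseteq> set vs" "set ys \<subseteq> set vs"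
      using us by auto
    \<comment> \<open>Over the union both inequalities live in one fiber of \<open>P\<close>, where
      antisymmetry applies; equal weakenings have equal classes.\<close>
    have "Rx P (wk (Base P) vs xs A) \<alpha> = Rx P (wk (Base P) vs ys A) \<beta>"
      using us(4)[rule_format, OF vs(1) sub(1)] ws(4)[rule_format, OF vs(1) sub(2)]
      by (rule fib_antisym) (use A vs sub \<alpha> \<beta> in \<open>auto intro: prd_obj LPrd_obj rx_wk_in\<close>)
    then show ?thesis
      using form_cls_wk[OF \<alpha> vs(1) sub(3) A] form_cls_wk[OF \<beta> vs(1) sub(4) A] k l by simp
  qed
  have trans: "form_le P \<Lambda> A k m" if le: "form_le P \<Lambda> A k l" "form_le P \<Lambda> A l m"
    and klm: "k \<in> carrier ?L" "l \<in> carrier ?L" "m \<in> carrier ?L" for k l m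
  proof -
    obtain \<alpha> xs where \<alpha>: "(\<alpha>, xs) \<in> form_reps P \<Lambda> A" and k: "k = form_cls P \<Lambda> A \<alpha> xs"
      using const_fibE[OF klm(1)] .
    obtain \<beta> ys where \<beta>: "(\<beta>, ys) \<in> form_reps P \<Lambda> A" and l: "l = form_cls P \<Lambda> A \<beta> ys"
      using const_fibE[OF klm(2)] .
    obtain \<gamma> ts where \<gamma>: "(\<gamma>, ts) \<in> form_reps P \<Lambda> A" and m: "m = form_cls P \<Lambda> A \<gamma> ts"
      using const_fibE[OF klm(3)] .
    obtain us where us: "us \<in> Ctx (Base P) \<Lambda>" "set xs \<subseteq> set us" "set ys \<subseteq> set us"
        "\<forall>vs\<in>Ctx (Base P) \<Lambda>. set us \<subseteq> set vs \<longrightarrow>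
          Rx P (wk (Base P) vs xs A) \<alpha> \<preceq>\<^bsub>LPrd (Base P) vs \<boxtimes>\<^bsub>Base P\<^esub> A\<^esub> Rx P (wk (Base P) vs ys A) \<beta>"
      using form_le_clsE[OF le(1)[unfolded k l] \<alpha> \<beta> A] .
    obtain ws where ws: "ws \<in> Ctx (Base P) \<Lambda>" "set ys \<subseteq> set ws" "set ts \<subseteq> set ws"
        "\<forall>vs\<in>Ctx (Base P) \<Lambda>. set ws \<subseteq> set vs \<longrightarrow>
          Rx P (wk (Base P) vs ys A) \<beta> \<preceq>\<^bsub>LPrd (Base P) vs \<boxtimes>\<^bsub>Base P\<^esub> A\<^esub> Rx P (wk (Base P) vs ts A) \<gamma>"
      using form_le_clsE[OF le(2)[unfolded l m] \<beta> \<gamma> A] .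
    obtain rs where rs: "rs \<in> Ctx (Base P) \<Lambda>" "set rs = set us \<union> set ws"
      using Ctx_Un_ex[OF us(1) ws(1)] .
    have "Rx P (wk (Base P) vs xs A) \<alpha> \<preceq>\<^bsub>LPrd (Base P) vs \<boxtimes>\<^bsub>Base P\<^esub> A\<^esub> Rx P (wk (Base P) vs ts A) \<gamma>"
      if vs: "vs \<in> Ctx (Base P) \<Lambda>" "set rs \<subseteq> set vs" for vs
    proof -
      have sub: "set us \<subseteq> set vs" "set ws \<subseteq> set vs"
          "set xs \<subseteq> set vs" "set ys \<subseteq> set vs" "set ts \<subseteq> set vs"
        using vs rs us ws by auto
      show ?thesis
        using us(4)[rule_format, OF vs(1) sub(1)] ws(4)[rule_format, OF vs(1) sub(2)]
        by (rule fib_trans) (use A vs sub \<alpha> \<beta> \<gamma> in \<open>auto intro: prd_obj LPrd_obj rx_wk_in\<close>)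
    qed
    moreover have "set xs \<subseteq> set rs" "set ts \<subseteq> set rs"
      using rs us ws by auto
    ultimately show ?thesis
      unfolding k m form_le_cls[OF \<alpha> \<gamma> A] using rs(1) by blast
  qed
  show ?thesis
    by unfold_locales (unfold eq_const_fib le_const_fib, (rule refl antisym trans, assumption+ | simp)+)
qed

end

section \<open>Meets, top and reindexing along the terminal arrow\<close>

context primary_doctrine
begin

abbreviation fib_meet (\<open>(_/ \<and>\<^bsub>_\<^esub> _)\<close> [71, 0, 71] 70) where
  "x \<and>\<^bsub>A\<^esub> y \<equiv> x \<sqinter>\<^bsub>Fib P A\<^esub> y"

abbreviation fib_top (\<open>\<T>\<^bsub>_\<^esub>\<close>) where
  "\<T>\<^bsub>A\<^esub> \<equiv> \<top>\<^bsub>Fib P A\<^esub>"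

lemma
  assumes "A \<in> Obj (Base P)" "x \<in> carrier (Fib P A)" "y \<in> carrier (Fib P A)"
  shows meet_in: "x \<and>\<^bsub>A\<^esub> y \<in> carrier (Fib P A)"
    and meet_le1: "x \<and>\<^bsub>A\<^esub> y \<preceq>\<^bsub>A\<^esub> x"
    and meet_le2: "x \<and>\<^bsub>A\<^esub> y \<preceq>\<^bsub>A\<^esub> y"
    and le_meetI: "\<lbrakk>z \<in> carrier (Fib P A); z \<preceq>\<^bsub>A\<^esub> x; z \<preceq>\<^bsub>A\<^esub> y\<rbrakk> \<Longrightarrow> z \<preceq>\<^bsub>A\<^esub> x \<and>\<^bsub>A\<^esub> y"
proof -
  interpret lower_semilattice "Fib P A" by (rule fib_meet[OF assms(1)])
  show "x \<and>\<^bsub>A\<^esub> y \<in> carrier (Fib P A)"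
    using assms(2,3) by (rule meet_closed)
  show "x \<and>\<^bsub>A\<^esub> y \<preceq>\<^bsub>A\<^esub> x" "x \<and>\<^bsub>A\<^esub> y \<preceq>\<^bsub>A\<^esub> y"
    using assms(2,3) by (rule meet_left, rule meet_right)
  show "\<lbrakk>z \<in> carrier (Fib P A); z \<preceq>\<^bsub>A\<^esub> x; z \<preceq>\<^bsub>A\<^esub> y\<rbrakk> \<Longrightarrow> z \<preceq>\<^bsub>A\<^esub> x \<and>\<^bsub>A\<^esub> y"
    using assms(2,3) by (simp add: meet_le)
qed

lemma
  assumes "A \<in> Obj (Base P)"
  shows top_in: "\<T>\<^bsub>A\<^esub> \<in> carrier (Fib P A)"
    and le_top: "x \<in> carrier (Fib P A) \<Longrightarrow> x \<preceq>\<^bsub>A\<^esub> \<T>\<^bsub>A\<^esub>"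
proof -
  interpret weak_partial_order_top "Fib P A" by (rule fib_top[OF assms])
  show "\<T>\<^bsub>A\<^esub> \<in> carrier (Fib P A)" "x \<in> carrier (Fib P A) \<Longrightarrow> x \<preceq>\<^bsub>A\<^esub> \<T>\<^bsub>A\<^esub>"
    by (rule top_closed, rule top_higher)
qed

lemma const_fib_meet:
  assumes A: "A \<in> Obj (Base P)"
  shows "lower_semilattice (Fib (const_doctrine P \<Lambda>) A)"
proof -
  let ?L = "Fib (const_doctrine P \<Lambda>) A"
  interpret partial_order ?L by (rule const_fib_poset[OF A])
  show ?thesis
  proof
    fix k l assume kl: "k \<in> carrier ?L" "l \<in> carrier ?L"
    obtain \<alpha>' xs where \<alpha>': "(\<alpha>', xs) \<in> form_reps P \<Lambda> A" and k': "k = form_cls P \<Lambda> A \<alpha>' xs"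
      using const_fibE[OF kl(1)] .
    obtain \<beta>' ys where \<beta>': "(\<beta>', ys) \<in> form_reps P \<Lambda> A" and l': "l = form_cls P \<Lambda> A \<beta>' ys"
      using const_fibE[OF kl(2)] .
    obtain zs where zs: "zs \<in> Ctx (Base P) \<Lambda>" "set zs = set xs \<union> set ys"
      using Ctx_Un_ex[of xs "Base P" \<Lambda> ys] \<alpha>' \<beta>' by (auto simp: form_reps_iff)
    let ?D = "\<lambda>zs. LPrd (Base P) zs \<boxtimes>\<^bsub>Base P\<^esub> A"
    \<comment> \<open>Both elements are rewritten over the common list \<open>zs\<close>, so that
      the meet can be taken in a single fiber of \<open>P\<close>.\<close>
    define \<alpha> where "\<alpha> = Rx P (wk (Base P) zs xs A) \<alpha>'"
    define \<beta> where "\<beta> = Rx P (wk (Base P) zs ys A) \<beta>'"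
    have \<alpha>: "(\<alpha>, zs) \<in> form_reps P \<Lambda> A" and \<beta>: "(\<beta>, zs) \<in> form_reps P \<Lambda> A"
      using zs rx_wk_in[OF \<alpha>' zs(1) _ A] rx_wk_in[OF \<beta>' zs(1) _ A] by (auto simp: form_reps_iff \<alpha>_def \<beta>_def)
    have k: "k = form_cls P \<Lambda> A \<alpha> zs" and l: "l = form_cls P \<Lambda> A \<beta> zs"
      using form_cls_wk[OF \<alpha>' zs(1) _ A] form_cls_wk[OF \<beta>' zs(1) _ A] zs k' l' by (auto simp: \<alpha>_def \<beta>_def)
    have D: "?D vs \<in> Obj (Base P)" if "vs \<in> Ctx (Base P) \<Lambda>" for vs
      using that A by (intro prd_obj LPrd_obj)
    have \<alpha>\<beta>: "\<alpha> \<in> carrier (Fib P (?D zs))" "\<beta> \<in> carrier (Fib P (?D zs))"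
      using \<alpha> \<beta> by (simp_all add: form_reps_iff)
    define \<mu> where "\<mu> = \<alpha> \<and>\<^bsub>?D zs\<^esub> \<beta>"
    have \<mu>: "(\<mu>, zs) \<in> form_reps P \<Lambda> A"
      using meet_in[OF D \<alpha>\<beta>] zs by (simp add: form_reps_iff \<mu>_def)
    have "greatest ?L (form_cls P \<Lambda> A \<mu> zs) (Lower ?L {k, l})"
    proof (rule greatest_LowerI)
      fix m assume "m \<in> {k, l}"
      then show "form_cls P \<Lambda> A \<mu> zs \<sqsubseteq>\<^bsub>?L\<^esub> m"
        using form_le_clsI[OF \<mu> \<alpha> A] form_le_clsI[OF \<mu> \<beta> A] meet_le1[OF D \<alpha>\<beta>] meet_le2[OF D \<alpha>\<beta>] zs k l
        by (auto simp: le_const_fib \<mu>_def)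
    next
      fix m assume "m \<in> Lower ?L {k, l}"
      then have m: "m \<in> carrier ?L" "form_le P \<Lambda> A m k" "form_le P \<Lambda> A m l"
        using kl by (auto simp: Lower_def le_const_fib)
      obtain \<gamma> ts where \<gamma>: "(\<gamma>, ts) \<in> form_reps P \<Lambda> A" and m': "m = form_cls P \<Lambda> A \<gamma> ts"
        using const_fibE[OF m(1)] .
      obtain us where us: "us \<in> Ctx (Base P) \<Lambda>" "set ts \<subseteq> set us" "set zs \<subseteq> set us"
          "\<forall>vs\<in>Ctx (Base P) \<Lambda>. set us \<subseteq> set vs \<longrightarrow>
            Rx P (wk (Base P) vs ts A) \<gamma> \<preceq>\<^bsub>?D vs\<^esub> Rx P (wk (Base P) vs zs A) \<alpha>"
        using form_le_clsE[OF m(2)[unfolded k m'] \<gamma> \<alpha> A] .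
      obtain ws where ws: "ws \<in> Ctx (Base P) \<Lambda>" "set ts \<subseteq> set ws" "set zs \<subseteq> set ws"
          "\<forall>vs\<in>Ctx (Base P) \<Lambda>. set ws \<subseteq> set vs \<longrightarrow>
            Rx P (wk (Base P) vs ts A) \<gamma> \<preceq>\<^bsub>?D vs\<^esub> Rx P (wk (Base P) vs zs A) \<beta>"
        using form_le_clsE[OF m(3)[unfolded l m'] \<gamma> \<beta> A] .
      obtain rs where rs: "rs \<in> Ctx (Base P) \<Lambda>" "set rs = set us \<union> set ws"
        using Ctx_Un_ex[OF us(1) ws(1)] .
      have "Rx P (wk (Base P) vs ts A) \<gamma> \<preceq>\<^bsub>?D vs\<^esub> Rx P (wk (Base P) vs zs A) \<mu>"
        if vs: "vs \<in> Ctx (Base P) \<Lambda>" "set rs \<subseteq> set vs" for vs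
      proof -
        have sub: "set us \<subseteq> set vs" "set ws \<subseteq> set vs" "set ts \<subseteq> set vs" "set zs \<subseteq> set vs"
          using vs rs us by auto
        \<comment> \<open>Weakening preserves meets, so the lower bound \<open>\<gamma>\<close> is
          compared with the two weakened factors separately.\<close>
        show ?thesis
          unfolding \<mu>_def rx_meet[OF wk_hom[OF zs(1) vs(1) sub(4) A] \<alpha>\<beta>]
          using us(4)[rule_format, OF vs(1) sub(1)] ws(4)[rule_format, OF vs(1) sub(2)]
          by (intro le_meetI D rx_wk_in[OF \<alpha>] rx_wk_in[OF \<beta>] rx_wk_in[OF \<gamma>] vs sub A)
      qed
      moreover have "set ts \<subseteq> set rs" "set zs \<subseteq> set rs"
        using rs us by auto
      ultimately have "form_le P \<Lambda> A m (form_cls P \<Lambda> A \<mu> zs)"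
        unfolding m' form_le_cls[OF \<gamma> \<mu> A] using rs(1) by blast
      then show "m \<sqsubseteq>\<^bsub>?L\<^esub> form_cls P \<Lambda> A \<mu> zs" by (simp add: le_const_fib)
    qed (use kl form_cls_in[OF \<mu>] in auto)
    then show "\<exists>i. greatest ?L i (Lower ?L {k, l})" ..
  qed
qed


text \<open>The representative over the empty list suffices, because weakening sends it to the top
  over every other list.\<close>

lemma const_fib_top:
  assumes A: "A \<in> Obj (Base P)"
  shows "greatest (Fib (const_doctrine P \<Lambda>) A) (form_cls P \<Lambda> A \<T>\<^bsub>Trm (Base P) \<boxtimes>\<^bsub>Base P\<^esub> A\<^esub> [])
    (carrier (Fib (const_doctrine P \<Lambda>) A))"
proof -
  let ?L = "Fib (const_doctrine P \<Lambda>) A" and ?\<tau> = "\<T>\<^bsub>Trm (Base P) \<boxtimes>\<^bsub>Base P\<^esub> A\<^esub>"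
  have \<tau>: "(?\<tau>, []) \<in> form_reps P \<Lambda> A"
    using top_in[OF prd_obj[OF trm_obj A]] by (simp add: form_reps_iff)
  have "form_le P \<Lambda> A k (form_cls P \<Lambda> A ?\<tau> [])" if "k \<in> carrier ?L" for k
  proof -
    obtain \<alpha> xs where \<alpha>: "(\<alpha>, xs) \<in> form_reps P \<Lambda> A" and k: "k = form_cls P \<Lambda> A \<alpha> xs"
      using const_fibE[OF \<open>k \<in> carrier ?L\<close>] .
    then have xs: "xs \<in> Ctx (Base P) \<Lambda>" by (simp add: form_reps_iff)
    have "Rx P (wk (Base P) vs xs A) \<alpha> \<preceq>\<^bsub>LPrd (Base P) vs \<boxtimes>\<^bsub>Base P\<^esub> A\<^esub> Rx P (wk (Base P) vs [] A) ?\<tau>"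
      if vs: "vs \<in> Ctx (Base P) \<Lambda>" "set xs \<subseteq> set vs" for vs
      using rx_top[OF wk_hom[OF Ctx_Nil vs(1) _ A]] le_top[OF prd_obj[OF LPrd_obj[OF vs(1)] A]]
        rx_wk_in[OF \<alpha> vs A] by simp
    with xs show ?thesis
      unfolding k form_le_cls[OF \<alpha> \<tau> A] by auto
  qed
  with form_cls_in[OF \<tau>] show ?thesis
    by (auto simp: greatest_def le_const_fib)
qed

text \<open>Over the terminal object the graph of an arrow is an identity, so every class in the
  union defining the reindexing is \<open>l\<close> again. It follows that
  \<open>henkin_conj_at\<close> over the terminal object is just \<open>henkin_conj\<close>.\<close>

lemma const_rx_bang_trm:
  assumes "l \<in> carrier (Fib (const_doctrine P \<Lambda>) (Trm (Base P)))"
  shows "Rx (const_doctrine P \<Lambda>) (bang (const_cat (Base P) \<Lambda>) (Trm (Base P))) l = l"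
proof -
  let ?T = "Trm (Base P)"
  obtain \<alpha> xs where \<alpha>: "(\<alpha>, xs) \<in> form_reps P \<Lambda> ?T" "l = form_cls P \<Lambda> ?T \<alpha> xs"
    using const_fibE[OF assms] .
  have *: "form_cls P \<Lambda> ?T (Rx P (graph (Base P) zs f ?T) \<beta>) zs = l"
    if "(f, zs) \<in> arr_reps (Base P) \<Lambda> ?T ?T" "(\<beta>, zs) \<in> l" for f zs \<beta>
  proof -
    have \<beta>: "(\<beta>, zs) \<in> form_reps P \<Lambda> ?T"
      using that(2) assms in_quotient_imp_subset[OF form_rel_equiv[OF trm_obj]]
      by (auto simp: carrier_const_fib)
    have "Rx P (graph (Base P) zs f ?T) \<beta> = \<beta>"
      using that(1) \<beta> graph_trm[of zs \<Lambda> f] rx_ide[OF prd_obj[OF LPrd_obj trm_obj]]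
      by (auto simp: arr_reps_def form_reps_iff)
    moreover have "form_cls P \<Lambda> ?T \<beta> zs = l"
      using that(2) equiv_class_eq[OF form_rel_equiv[OF trm_obj], of "(\<alpha>, xs)" "(\<beta>, zs)"]
      by (simp add: \<alpha>(2) form_cls_def)
    ultimately show ?thesis by simp
  qed
  have "(\<alpha>, xs) \<in> l"
    using equiv_class_self[OF form_rel_equiv[OF trm_obj] \<alpha>(1)] by (simp add: \<alpha>(2) form_cls_def)
  \<comment> \<open>The union must range over at least one pair: this arrow lives over the same list
    as the representative of \<open>l\<close>.\<close>
  moreover have "(Pr2 (Base P) (LPrd (Base P) xs) ?T, xs) \<in> arr_reps (Base P) \<Lambda> ?T ?T"
    using \<alpha> pr2_hom[OF LPrd_obj trm_obj] by (auto simp: arr_reps_def form_reps_iff)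
  ultimately have "{form_cls P \<Lambda> ?T (Rx P (graph (Base P) zs f ?T) \<beta>) zs | f \<beta> zs.
      (f, zs) \<in> arr_reps (Base P) \<Lambda> ?T ?T \<and> (\<beta>, zs) \<in> l} = {l}"
    using * by (intro equalityI subsetI) (fastforce, blast)
  then show ?thesis
    by (simp add: bang_const_cat_trm const_doctrine_def)
qed

end

section \<open>Henkin axioms\<close>

lemma finite_sorted_wrt_list_ex:
  assumes "finite W" and "\<And>x y. \<lbrakk>x \<in> W; y \<in> W\<rbrakk> \<Longrightarrow> R x y \<or> R y x"
    and "\<And>x y z. \<lbrakk>x \<in> W; y \<in> W; z \<in> W; R x y; R y z\<rbrakk> \<Longrightarrow> R x z"
  shows "\<exists>ws. set ws = W \<and> distinct ws \<and> sorted_wrt R ws"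
  using assms
proof (induction W rule: finite_induct)
  case empty
  show ?case by simp
next
  case (insert x W)
  have "\<exists>ws. set ws = W \<and> distinct ws \<and> sorted_wrt R ws"
  proof (rule insert.IH)
    show "R y z \<or> R z y" if "y \<in> W" "z \<in> W" for y z
      using insert.prems(1)[of y z] that by simp
    show "R u z" if "u \<in> W" "y \<in> W" "z \<in> W" "R u y" "R y z" for u y z
      using insert.prems(2)[of u y z] that by simp
  qed
  then obtain ws where ws: "set ws = W" "distinct ws" "sorted_wrt R ws"
    by blast
  \<comment> \<open>The new element is placed after everything related to it; by totality it is
    itself related to all the remaining elements.\<close>
  define us where "us = filter (\<lambda>y. R y x) ws @ [x] @ filter (\<lambda>y. \<not> R y x) ws"
  have "set us = insert x W" "distinct us"
    using ws insert.hyps(2) by (auto simp: us_def)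
  moreover have "sorted_wrt R us"
  proof -
    have 1: "R x z" if "z \<in> set ws" "\<not> R z x" for z
      using insert.prems(1)[of x z] ws(1) that by simp
    have 2: "R y z" if "y \<in> set ws" "R y x" "z \<in> set ws" "\<not> R z x" for y z
      using insert.prems(2)[of y x z] 1[of z] ws(1) that by simp
    from 1 2 ws(3) show ?thesis
      unfolding us_def sorted_wrt_append by (auto intro: sorted_wrt_filter)
  qed
  ultimately show ?case by blast
qed

section \<open>Rules for implication, bottom and the existential quantifier\<close>

context implicational_doctrine
begin

text \<open>Any two elements satisfying \<open>is_himp\<close> lie below each other, so antisymmetry
  makes the definite description in \<open>himp\<close> denote.\<close>

lemma
  assumes A: "A \<in> Obj (Base P)" and a: "a \<in> carrier (Fib P A)" and b: "b \<in> carrier (Fib P A)"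
  shows himp_in: "himp (Fib P A) a b \<in> carrier (Fib P A)"
    and le_himp_iff: "x \<in> carrier (Fib P A) \<Longrightarrow>
      x \<preceq>\<^bsub>A\<^esub> himp (Fib P A) a b \<longleftrightarrow> x \<and>\<^bsub>A\<^esub> a \<preceq>\<^bsub>A\<^esub> b"
proof -
  obtain z where z: "is_himp (Fib P A) a b z"
    using fib_himp[OF A a b] ..
  moreover have "y = z" if "is_himp (Fib P A) a b y" for y
    using that z fib_refl[OF A] by (intro fib_antisym[OF _ _ A]) (auto simp: is_himp_def)
  ultimately have "himp (Fib P A) a b = z"
    unfolding himp_def by (intro the_equality)
  with z show "himp (Fib P A) a b \<in> carrier (Fib P A)"
    "x \<in> carrier (Fib P A) \<Longrightarrow> x \<preceq>\<^bsub>A\<^esub> himp (Fib P A) a b \<longleftrightarrow> x \<and>\<^bsub>A\<^esub> a \<preceq>\<^bsub>A\<^esub> b"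
    by (auto simp: is_himp_def)
qed

end

context heyting_doctrine
begin

lemma
  assumes "A \<in> Obj (Base P)"
  shows bot_in: "\<bottom>\<^bsub>Fib P A\<^esub> \<in> carrier (Fib P A)"
    and bot_le: "x \<in> carrier (Fib P A) \<Longrightarrow> \<bottom>\<^bsub>Fib P A\<^esub> \<preceq>\<^bsub>A\<^esub> x"
proof -
  interpret bounded_lattice "Fib P A" by (rule fib_lattice[OF assms])
  show "\<bottom>\<^bsub>Fib P A\<^esub> \<in> carrier (Fib P A)" "x \<in> carrier (Fib P A) \<Longrightarrow> \<bottom>\<^bsub>Fib P A\<^esub> \<preceq>\<^bsub>A\<^esub> x"
    by (rule bottom_closed, rule bottom_lower)
qed

end

context existential_doctrine
begin

lemma
  assumes B: "B \<in> Obj (Base P)" and D: "D \<in> Obj (Base P)"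
    and x: "x \<in> carrier (Fib P (D \<boxtimes>\<^bsub>Base P\<^esub> B))"
  shows exq_in: "exq P D B x \<in> carrier (Fib P D)"
    and exq_le_iff: "y \<in> carrier (Fib P D) \<Longrightarrow>
      exq P D B x \<preceq>\<^bsub>D\<^esub> y \<longleftrightarrow> x \<preceq>\<^bsub>D \<boxtimes>\<^bsub>Base P\<^esub> B\<^esub> Rx P (Pr1 (Base P) D B) y"
proof -
  have "is_exq P D B (exq P D B)"
    unfolding exq_def by (rule someI_ex[OF exq_ex[OF B D]])
  then interpret galois_connection "\<lparr>orderA = Fib P (D \<boxtimes>\<^bsub>Base P\<^esub> B), orderB = Fib P D,
      lower = exq P D B, upper = Rx P (Pr1 (Base P) D B)\<rparr>"
    by (simp add: is_exq_def)
  show "exq P D B x \<in> carrier (Fib P D)"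
    using lower_closed x by simp
  show "exq P D B x \<preceq>\<^bsub>D\<^esub> y \<longleftrightarrow> x \<preceq>\<^bsub>D \<boxtimes>\<^bsub>Base P\<^esub> B\<^esub> Rx P (Pr1 (Base P) D B) y" if "y \<in> carrier (Fib P D)"
    using left[of x y] right[of x y] x that by auto
qed

end

section \<open>Setting, and elimination of a single Henkin axiom\<close>

locale henkin = heyting_doctrine P + existential_doctrine P
  for P :: "('o, 'a, 'p) indexed_poset" +
  fixes \<Lambda> :: "'l rel" and \<phi> :: "'o \<Rightarrow> 'l \<Rightarrow> 'p" and X :: "'o \<Rightarrow> 'l \<Rightarrow> ('o, 'l) ctx"
  assumes nontrivial: "A \<in> Obj (Base P) \<Longrightarrow> \<not> is_singleton (carrier (Fib P A))"
    and well_order: "Well_order \<Lambda>"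
    and listing: "henkin_listing P \<Lambda> \<phi> X"
begin

abbreviation (input) "C \<equiv> Base P"

abbreviation prod_obj (infixl \<open>\<bullet>\<close> 75) where "A \<bullet> B \<equiv> A \<boxtimes>\<^bsub>Base P\<^esub> B"

abbreviation bot (\<open>\<F>\<^bsub>_\<^esub>\<close>) where "\<F>\<^bsub>A\<^esub> \<equiv> \<bottom>\<^bsub>Fib P A\<^esub>"

lemma top_not_le_bot:
  assumes A: "A \<in> Obj C"
  shows "\<not> \<T>\<^bsub>A\<^esub> \<preceq>\<^bsub>A\<^esub> \<F>\<^bsub>A\<^esub>"
proof
  assume le: "\<T>\<^bsub>A\<^esub> \<preceq>\<^bsub>A\<^esub> \<F>\<^bsub>A\<^esub>"
  have "x = \<T>\<^bsub>A\<^esub>" if x: "x \<in> carrier (Fib P A)" for x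
  proof (rule fib_antisym[OF le_top[OF A x] _ A x top_in[OF A]])
    show "\<T>\<^bsub>A\<^esub> \<preceq>\<^bsub>A\<^esub> x"
      by (rule fib_trans[OF le bot_le[OF A x] A top_in[OF A] bot_in[OF A] x])
  qed
  then have "carrier (Fib P A) = {\<T>\<^bsub>A\<^esub>}"
    using top_in[OF A] by blast
  with nontrivial[OF A] show False
    by (simp add: is_singleton_def)
qed

text \<open>One application of this result removes one axiom. The conclusion stays over
  \<open>D \<bullet> B\<close>: inconsistency need not descend along the projection to
  \<open>D\<close>.\<close>

lemma henkin_axiom_conservative:
  assumes D: "D \<in> Obj C" and B: "B \<in> Obj C"
    and c: "c \<in> carrier (Fib P D)" and f: "f \<in> carrier (Fib P (D \<bullet> B))"
    and bot: "himp (Fib P (D \<bullet> B)) (Rx P (Pr1 C D B) (exq P D B f)) f \<and>\<^bsub>D \<bullet> B\<^esub> Rx P (Pr1 C D B) c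
      \<preceq>\<^bsub>D \<bullet> B\<^esub> \<F>\<^bsub>D \<bullet> B\<^esub>"
  shows "Rx P (Pr1 C D B) c \<preceq>\<^bsub>D \<bullet> B\<^esub> \<F>\<^bsub>D \<bullet> B\<^esub>"
proof -
  let ?E = "D \<bullet> B" and ?p = "Rx P (Pr1 C D B)"
  let ?e = "exq P D B f"
  let ?h = "himp (Fib P ?E) (?p ?e) f"
  note E = prd_obj[OF D B]
  note p = pr1_hom[OF D B]
  note e = exq_in[OF B D f]
  note pe = rx_in[OF p e] and pc = rx_in[OF p c]
  note h = himp_in[OF E pe f]
  note bE = bot_in[OF E]
  \<comment> \<open>The conclusion of an implication entails the implication, so \<open>f\<close> is
    incompatible with the reindexed \<open>c\<close>.\<close>
  have "f \<preceq>\<^bsub>?E\<^esub> ?h"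
    using le_himp_iff[OF E pe f f] meet_le1[OF E f pe] by blast
  then have "f \<and>\<^bsub>?E\<^esub> ?p c \<preceq>\<^bsub>?E\<^esub> ?h \<and>\<^bsub>?E\<^esub> ?p c"
    by (intro le_meetI[OF E h pc] meet_in[OF E f pc] meet_le2[OF E f pc]
        fib_trans[OF meet_le1[OF E f pc] _ E meet_in[OF E f pc] f h])
  then have "f \<and>\<^bsub>?E\<^esub> ?p c \<preceq>\<^bsub>?E\<^esub> \<F>\<^bsub>?E\<^esub>"
    by (rule fib_trans[OF _ bot E meet_in[OF E f pc] meet_in[OF E h pc] bE])
  then have "f \<preceq>\<^bsub>?E\<^esub> himp (Fib P ?E) (?p c) \<F>\<^bsub>?E\<^esub>"
    using le_himp_iff[OF E pc bE f] by blast
  \<comment> \<open>Reindexing preserves negation, so the upper bound on \<open>f\<close> is pulled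
    back from \<open>D\<close>; only such bounds transpose across the adjunction for the
    quantifier.\<close>
  also have "himp (Fib P ?E) (?p c) \<F>\<^bsub>?E\<^esub> = ?p (himp (Fib P D) c \<F>\<^bsub>D\<^esub>)"
    by (simp add: rx_himp[OF p c bot_in[OF D]] rx_bot[OF p])
  finally have "?e \<preceq>\<^bsub>D\<^esub> himp (Fib P D) c \<F>\<^bsub>D\<^esub>"
    using exq_le_iff[OF B D f himp_in[OF D c bot_in[OF D]]] by blast
  then have "?p ?e \<preceq>\<^bsub>?E\<^esub> himp (Fib P ?E) (?p c) \<F>\<^bsub>?E\<^esub>"
    using rx_le[OF p _ e himp_in[OF D c bot_in[OF D]]]
    by (simp add: rx_himp[OF p c bot_in[OF D]] rx_bot[OF p])
  then have "?p c \<and>\<^bsub>?E\<^esub> ?p ?e \<preceq>\<^bsub>?E\<^esub> \<F>\<^bsub>?E\<^esub>"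
    using le_himp_iff[OF E pc bE pe] by (simp add: meet_comm)
  \<comment> \<open>Ex falso: under the reindexed \<open>c\<close> the antecedent of the Henkin
    axiom is refuted, so the axiom holds vacuously and is not an additional assumption.\<close>
  then have "?p c \<and>\<^bsub>?E\<^esub> ?p ?e \<preceq>\<^bsub>?E\<^esub> f"
    by (rule fib_trans[OF _ bot_le[OF E f] E meet_in[OF E pc pe] bE f])
  then have "?p c \<preceq>\<^bsub>?E\<^esub> ?h"
    using le_himp_iff[OF E pe f pc] by blast
  then have "?p c \<preceq>\<^bsub>?E\<^esub> ?h \<and>\<^bsub>?E\<^esub> ?p c"
    by (intro le_meetI[OF E h pc pc] fib_refl[OF E pc])
  then show ?thesis
    by (rule fib_trans[OF _ bot E pc meet_in[OF E h pc] bE])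
qed

section \<open>Ordinals and freshness of the Henkin constants\<close>

abbreviation d :: "'o \<times> 'l \<Rightarrow> 'l" where
  "d w \<equiv> d_ord \<Lambda> X (fst w) (snd w)"

abbreviation Xs :: "'o \<times> 'l \<Rightarrow> ('o, 'l) ctx" where
  "Xs w \<equiv> X_star \<Lambda> X (fst w) (snd w)"

abbreviation Idx :: "('o \<times> 'l) set" where
  "Idx \<equiv> Obj C \<times> Field \<Lambda>"

lemma wo: "wo_rel \<Lambda>"
  using well_order by (simp add: wo_rel_def)

text \<open>The well-founded recursion unfolds because \<open>d_bounds\<close> at \<open>j\<close>
  consults the function only strictly below \<open>j\<close>. The successor is then a strict upper
  bound because the listing guarantees that strict upper bounds exist.\<close>

lemma d_ord_AboveS:
  assumes "B \<in> Obj C" "j \<in> Field \<Lambda>"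
  shows "d_ord \<Lambda> X B j \<in> AboveS \<Lambda> (d_bounds \<Lambda> X B (d_ord \<Lambda> X B) j)"
proof -
  let ?H = "\<lambda>d j. wo_rel.suc \<Lambda> (d_bounds \<Lambda> X B d j)"
  have "wo_rel.adm_wo \<Lambda> ?H"
  proof -
    have "d_bounds \<Lambda> X B f x = d_bounds \<Lambda> X B g x" if "\<forall>y\<in>underS \<Lambda> x. f y = g y" for f g x
      using that by (simp add: d_bounds_def image_def)
    then show ?thesis
      unfolding wo_rel.adm_wo_def[OF wo] by metis
  qed
  from wo_rel.worec_fixpoint[OF wo this]
  have "d_ord \<Lambda> X B j = wo_rel.suc \<Lambda> (d_bounds \<Lambda> X B (d_ord \<Lambda> X B) j)"
    unfolding d_ord_def by metis
  moreover have ne: "AboveS \<Lambda> (d_bounds \<Lambda> X B (d_ord \<Lambda> X B) j) \<noteq> {}"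
    using listing assms by (simp add: henkin_listing_def)
  \<comment> \<open>Being related to a strict upper bound puts each bound in the field of the order,
    as \<open>suc_AboveS\<close> requires.\<close>
  moreover have "d_bounds \<Lambda> X B (d_ord \<Lambda> X B) j \<subseteq> Field \<Lambda>"
    using ne by (auto simp: AboveS_def intro: FieldI1)
  ultimately show ?thesis
    using wo_rel.suc_AboveS[OF wo] by metis
qed

lemma d_in: "w \<in> Idx \<Longrightarrow> d w \<in> Field \<Lambda>"
  using d_ord_AboveS[of "fst w" "snd w"] by (auto simp: AboveS_def)

text \<open>For a fixed sort the values increase strictly with the index. Values for different sorts
  are computed independently and may coincide.\<close>

lemma d_inj:
  assumes "(B, i) \<in> Idx" "(B, j) \<in> Idx" "i \<noteq> j"
  shows "d (B, i) \<noteq> d (B, j)"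
proof -
  have *: "d (B, i) \<noteq> d (B, j)" if "i \<in> underS \<Lambda> j" "(B, j) \<in> Idx" for i j
  proof -
    have "d (B, i) \<in> d_bounds \<Lambda> X B (d_ord \<Lambda> X B) j"
      using that(1) by (simp add: d_bounds_def)
    then show ?thesis
      using d_ord_AboveS[of B j] that(2) unfolding AboveS_def by fastforce
  qed
  have "i \<in> underS \<Lambda> j \<or> j \<in> underS \<Lambda> i"
    using wo_rel.TOTALS[OF wo] assms by (auto simp: underS_def)
  with *[of i j] *[of j i] assms show ?thesis by metis
qed

lemma X_less_d:
  assumes "w \<in> Idx" "e \<in> set (X (fst w) (snd w))"
  shows "(snd e, d w) \<in> \<Lambda>" "snd e \<noteq> d w"
proof -
  have "(snd w, snd w) \<in> \<Lambda>"
    using wo_rel.REFL[OF wo] assms(1) by (auto simp: refl_on_def)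
  \<comment> \<open>The bounds at an index include the ordinals of the list at that same index, by
    reflexivity of the order.\<close>
  then have "snd e \<in> d_bounds \<Lambda> X (fst w) (d_ord \<Lambda> X (fst w)) (snd w)"
    using assms(2) by (auto simp: d_bounds_def under_def)
  then show "(snd e, d w) \<in> \<Lambda>" "snd e \<noteq> d w"
    using d_ord_AboveS[of "fst w" "snd w"] assms(1) by (auto simp: AboveS_def)
qed

lemma listed_form: "w \<in> Idx \<Longrightarrow> (\<phi> (fst w) (snd w), X (fst w) (snd w)) \<in> form_reps P \<Lambda> (fst w)"
  using listing by (auto simp: henkin_listing_def)

lemma Xs_eq: "Xs w = X (fst w) (snd w) @ [(fst w, d w)]"
  by (simp add: X_star_def)

lemma Xs_in:
  assumes "w \<in> Idx"
  shows "Xs w \<in> Ctx C \<Lambda>"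
  using listed_form[OF assms] X_less_d(2)[OF assms, of "(fst w, d w)"] assms d_in[OF assms]
  by (auto simp: Xs_eq Ctx_snoc form_reps_iff)

text \<open>If the constant of \<open>w\<close> occurred in the list of the formula of
  \<open>w'\<close>, its ordinal would be strictly below \<open>d w'\<close>, against the assumed
  comparison. If it were the new constant of \<open>w'\<close>, the sorts and ordinals would agree,
  against \<open>d_inj\<close>. A tie of ordinals is harmless, since constants of different sorts
  differ.\<close>

lemma fresh:
  assumes "w \<in> Idx" "w' \<in> Idx" "w \<noteq> w'" "(d w', d w) \<in> \<Lambda>"
  shows "(fst w, d w) \<notin> set (Xs w')"
proof
  assume "(fst w, d w) \<in> set (Xs w')"
  then consider "(fst w, d w) \<in> set (X (fst w') (snd w'))" | "fst w = fst w'" "d w = d w'"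
    by (auto simp: Xs_eq)
  then show False
  proof cases
    case 1
    from X_less_d[OF assms(2) this] assms(4) wo_rel.ANTISYM[OF wo]
    show False by (auto dest: antisymD)
  next
    case 2
    with d_inj[of "fst w" "snd w" "snd w'"] assms(1-3) show False
      by (auto simp: prod_eq_iff)
  qed
qed

section \<open>Henkin axioms over a common list\<close>

lemma henkin_form_in:
  assumes "w \<in> Idx"
  shows "henkin_form P \<phi> X (fst w) (snd w) \<in> carrier (Fib P (LPrd C (Xs w)))"
proof -
  note f = listed_form[OF assms]
  have D: "LPrd C (X (fst w) (snd w)) \<in> Obj C" and B: "fst w \<in> Obj C"
    using f assms by (auto simp: form_reps_iff intro: LPrd_obj)
  have f': "\<phi> (fst w) (snd w) \<in> carrier (Fib P (LPrd C (X (fst w) (snd w)) \<bullet> fst w))"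
    using f by (simp add: form_reps_iff)
  show ?thesis
    using himp_in[OF prd_obj[OF D B] rx_in[OF pr1_hom[OF D B] exq_in[OF B D f']] f']
    by (simp add: henkin_form_def Let_def Xs_eq)
qed

text \<open>The axiom is placed over the bare product of the list, without the terminal factor
  carried by sentences, so that a constant moved to the end of the list is the last factor of the
  base object.\<close>

definition ax :: "('o, 'l) ctx \<Rightarrow> 'o \<times> 'l \<Rightarrow> 'p" where
  "ax zs w = Rx P (ctx_proj C zs (Xs w)) (henkin_form P \<phi> X (fst w) (snd w))"

text \<open>A conjunction along a list rather than over a set, so that axioms can be removed from
  the head in a prescribed order.\<close>

definition conj_ax :: "('o, 'l) ctx \<Rightarrow> ('o \<times> 'l) list \<Rightarrow> 'p" where
  "conj_ax zs ws = foldr (\<lambda>w m. ax zs w \<and>\<^bsub>LPrd C zs\<^esub> m) ws \<T>\<^bsub>LPrd C zs\<^esub>"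

lemma conj_ax_simps [simp]:
  "conj_ax zs [] = \<T>\<^bsub>LPrd C zs\<^esub>"
  "conj_ax zs (w # ws) = ax zs w \<and>\<^bsub>LPrd C zs\<^esub> conj_ax zs ws"
  by (simp_all add: conj_ax_def)

text \<open>Under this condition every projection used in \<open>ax zs w\<close> with
  \<open>w \<in> W\<close> exists: \<open>zs\<close> contains the constants of the formulas and also
  the new Henkin constants.\<close>

definition covers :: "('o, 'l) ctx \<Rightarrow> ('o \<times> 'l) set \<Rightarrow> bool" where
  "covers zs W \<longleftrightarrow> zs \<in> Ctx C \<Lambda> \<and> W \<subseteq> Idx \<and> (\<forall>w\<in>W. set (Xs w) \<subseteq> set zs)"

lemma covers_insert: "covers zs (insert w W) \<longleftrightarrow> covers zs {w} \<and> covers zs W"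
  by (auto simp: covers_def)

lemma covers_mono: "\<lbrakk>covers zs W; vs \<in> Ctx C \<Lambda>; set zs \<subseteq> set vs\<rbrakk> \<Longrightarrow> covers vs W"
  by (auto simp: covers_def)

lemma covers_ctx: "covers zs W \<Longrightarrow> zs \<in> Ctx C \<Lambda>"
  by (simp add: covers_def)

lemma ax_in:
  assumes "covers zs {w}"
  shows "ax zs w \<in> carrier (Fib P (LPrd C zs))"
proof -
  have "w \<in> Idx" "zs \<in> Ctx C \<Lambda>" "set (Xs w) \<subseteq> set zs"
    using assms by (auto simp: covers_def)
  then show ?thesis
    unfolding ax_def by (intro rx_in[OF ctx_proj_hom[OF Xs_in] henkin_form_in])
qed

lemma conj_ax_in: "covers zs (set ws) \<Longrightarrow> conj_ax zs ws \<in> carrier (Fib P (LPrd C zs))"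
proof (induction ws)
  case Nil
  then show ?case using top_in[OF LPrd_obj[OF covers_ctx]] by simp
next
  case (Cons w ws)
  then have "covers zs {w}" "covers zs (set ws)"
    using covers_insert[of zs w "set ws"] by simp_all
  with Cons.IH show ?case
    using meet_in[OF LPrd_obj[OF covers_ctx] ax_in] by simp
qed

lemma rx_ax:
  assumes "covers zs {w}" and vs: "vs \<in> Ctx C \<Lambda>" and sub: "set zs \<subseteq> set vs"
  shows "Rx P (ctx_proj C vs zs) (ax zs w) = ax vs w"
proof -
  have w: "w \<in> Idx" and zs: "zs \<in> Ctx C \<Lambda>" and Xs: "set (Xs w) \<subseteq> set zs"
    using assms(1) by (auto simp: covers_def)
  show ?thesis
    unfolding ax_def
    by (simp add: rx_comp[OF ctx_proj_hom[OF zs vs sub] ctx_proj_hom[OF Xs_in[OF w] zs Xs]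
          henkin_form_in[OF w], symmetric] ctx_proj_comp[OF Xs_in[OF w] zs vs Xs sub])
qed

lemma rx_conj_ax:
  assumes "covers zs (set ws)" and vs: "vs \<in> Ctx C \<Lambda>" and sub: "set zs \<subseteq> set vs"
  shows "Rx P (ctx_proj C vs zs) (conj_ax zs ws) = conj_ax vs ws"
  using assms(1)
proof (induction ws)
  case Nil
  then show ?case
    using rx_top[OF ctx_proj_hom[OF covers_ctx vs sub]] by simp
next
  case (Cons w ws)
  then have c: "covers zs {w}" "covers zs (set ws)"
    using covers_insert[of zs w "set ws"] by simp_all
  show ?case
    using rx_meet[OF ctx_proj_hom[OF covers_ctx[OF c(1)] vs sub] ax_in[OF c(1)] conj_ax_in[OF c(2)]]
      rx_ax[OF c(1) vs sub] Cons.IH[OF c(2)] by simp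
qed

lemma conj_ax_le:
  assumes "covers zs (set ws)" "w \<in> set ws"
  shows "conj_ax zs ws \<preceq>\<^bsub>LPrd C zs\<^esub> ax zs w"
  using assms
proof (induction ws)
  case (Cons v ws)
  then have c: "covers zs {v}" "covers zs (set ws)"
    using covers_insert[of zs v "set ws"] by simp_all
  note D = LPrd_obj[OF covers_ctx[OF c(1)]]
  note v = ax_in[OF c(1)] and ws = conj_ax_in[OF c(2)]
  show ?case
  proof (cases "w = v")
    case True
    then show ?thesis using meet_le1[OF D v ws] by simp
  next
    case False
    then have w: "w \<in> set ws" using Cons.prems by simp
    then have "covers zs {w}" using c(2) by (auto simp: covers_def)
    then show ?thesis
      using fib_trans[OF meet_le2[OF D v ws] Cons.IH[OF c(2) w] D meet_in[OF D v ws] ws ax_in] by simp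
  qed
qed simp

text \<open>Naturality of \<open>Pr1\<close> and Beck-Chevalley move the weakening inside the
  quantifier. The result is again a Henkin axiom, now for the weakened formula, as
  \<open>henkin_axiom_conservative\<close> demands.\<close>

lemma ax_snoc:
  assumes w: "w \<in> Idx" and zs: "zs @ [(fst w, d w)] \<in> Ctx C \<Lambda>"
    and sub: "set (X (fst w) (snd w)) \<subseteq> set zs"
  defines "f \<equiv> Rx P (wk C zs (X (fst w) (snd w)) (fst w)) (\<phi> (fst w) (snd w))"
  shows "ax (zs @ [(fst w, d w)]) w = himp (Fib P (LPrd C zs \<bullet> fst w))
    (Rx P (Pr1 C (LPrd C zs) (fst w)) (exq P (LPrd C zs) (fst w) f)) f"
proof -
  define B xs g where "B = fst w" and "xs = X (fst w) (snd w)" and "g = \<phi> (fst w) (snd w)"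
  note defs = this
  have g': "(g, xs) \<in> form_reps P \<Lambda> B"
    using listed_form[OF w] by (simp add: defs)
  have xs: "xs \<in> Ctx C \<Lambda>" and g: "g \<in> carrier (Fib P (LPrd C xs \<bullet> B))"
    using g' by (simp_all add: form_reps_iff)
  have B: "B \<in> Obj C" and zs': "zs \<in> Ctx C \<Lambda>"
    using w zs by (auto simp: defs Ctx_snoc)
  have sub': "set xs \<subseteq> set zs" using sub by (simp add: defs)
  let ?D = "LPrd C xs" and ?E = "LPrd C zs"
  note D = LPrd_obj[OF xs] and E = LPrd_obj[OF zs']
  note p = ctx_proj_hom[OF xs zs' sub']
  note t = times_id_hom[OF p B]
  note q = pr1_hom[OF D B] and r = pr1_hom[OF E B]
  note e = exq_in[OF B D g]
  have "ctx_proj C (zs @ [(B, d w)]) (xs @ [(B, d w)]) = wk C zs xs B"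
    using ctx_proj_snoc_snoc[of xs "(B, d w)" \<Lambda> zs] Xs_in[OF w] zs sub' by (simp add: defs Xs_eq)
  then have "ax (zs @ [(B, d w)]) w
      = Rx P (wk C zs xs B) (himp (Fib P (?D \<bullet> B)) (Rx P (Pr1 C ?D B) (exq P ?D B g)) g)"
    by (simp add: ax_def henkin_form_def Let_def Xs_eq defs)
  also have "\<dots> = himp (Fib P (?E \<bullet> B)) (Rx P (wk C zs xs B) (Rx P (Pr1 C ?D B) (exq P ?D B g)))
      (Rx P (wk C zs xs B) g)"
    by (rule rx_himp[OF t rx_in[OF q e] g])
  also have "Rx P (wk C zs xs B) (Rx P (Pr1 C ?D B) (exq P ?D B g))
      = Rx P (Pr1 C ?E B) (Rx P (ctx_proj C zs xs) (exq P ?D B g))"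
    by (simp add: rx_comp[OF t q e, symmetric] rx_comp[OF r p e, symmetric] pr1_times_id[OF p B])
  also have "Rx P (ctx_proj C zs xs) (exq P ?D B g) = exq P ?E B (Rx P (wk C zs xs B) g)"
    by (rule beck_chevalley[OF B p g, symmetric])
  finally show ?thesis
    by (simp add: f_def defs)
qed

lemma conj_ax_not_le_bot:
  assumes "distinct ws" "sorted_wrt (\<lambda>w w'. (d w', d w) \<in> \<Lambda>) ws" "covers zs (set ws)"
  shows "\<not> conj_ax zs ws \<preceq>\<^bsub>LPrd C zs\<^esub> \<F>\<^bsub>LPrd C zs\<^esub>"
  using assms
proof (induction ws arbitrary: zs)
  case Nil
  then show ?case using top_not_le_bot[OF LPrd_obj[OF covers_ctx]] by simp
next
  case (Cons w ws)
  have zs: "zs \<in> Ctx C \<Lambda>" and w: "w \<in> Idx" and ws: "set ws \<subseteq> Idx" and Xw: "set (Xs w) \<subseteq> set zs"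
    using Cons.prems(3) by (auto simp: covers_def)
  define e where "e = (fst w, d w)"
  \<comment> \<open>Moving \<open>e\<close> to the end makes it the last factor;
    \<open>us @ [e]\<close> is a permutation of \<open>zs\<close>.\<close>
  define us where "us = remove1 e zs"
  have e: "e \<in> set zs" "fst e = fst w" "e \<in> Idx"
    using Xw zs by (auto simp: e_def Xs_eq Ctx_iff)
  have dz: "distinct zs" using zs by (simp add: Ctx_iff)
  have us: "us @ [e] \<in> Ctx C \<Lambda>" "set (us @ [e]) = set zs" "set us = set zs - {e}" "us \<in> Ctx C \<Lambda>"
    using zs e dz by (auto simp: us_def Ctx_iff)
  have cov: "covers (us @ [e]) (set (w # ws))"
    using covers_mono[OF Cons.prems(3) us(1)] us(2) by simp
  have covws: "covers (us @ [e]) (set ws)"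
    using cov covers_insert[of "us @ [e]" w "set ws"] by simp
  \<comment> \<open>By the sorting, the ordinals of the remaining axioms are at most
    \<open>d w\<close>, so freshness applies and these axioms are defined already over
    \<open>us\<close>.\<close>
  have "e \<notin> set (Xs w')" if "w' \<in> set ws" for w'
    unfolding e_def using that ws Cons.prems(1,2) by (intro fresh[OF w]) auto
  then have covus: "covers us (set ws)"
    using covws us by (auto simp: covers_def)
  have Xus: "set (X (fst w) (snd w)) \<subseteq> set us"
    using Xw us(3) X_less_d(2)[OF w, of e] by (auto simp: Xs_eq e_def)
  note D = LPrd_obj[OF us(4)]
  have B: "fst w \<in> Obj C" using w by auto
  have f: "Rx P (wk C us (X (fst w) (snd w)) (fst w)) (\<phi> (fst w) (snd w))
      \<in> carrier (Fib P (LPrd C us \<bullet> fst w))"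
    by (rule rx_wk_in[OF listed_form[OF w] us(4) Xus B])
  \<comment> \<open>The remaining conjunction is pulled back along the projection forgetting
    \<open>e\<close>: it is the \<open>c\<close> of the elimination result.\<close>
  have drop: "conj_ax (us @ [e]) ws = Rx P (Pr1 C (LPrd C us) (fst w)) (conj_ax us ws)"
    using rx_conj_ax[OF covus us(1)] ctx_proj_snoc[OF us(1)] e(2) by (simp add: subset_insertI)
  show ?case
  proof
    assume "conj_ax zs (w # ws) \<preceq>\<^bsub>LPrd C zs\<^esub> \<F>\<^bsub>LPrd C zs\<^esub>"
    note h = ctx_proj_hom[OF zs us(1) equalityD2[OF us(2)]]
    have "conj_ax (us @ [e]) (w # ws) \<preceq>\<^bsub>LPrd C (us @ [e])\<^esub> \<F>\<^bsub>LPrd C (us @ [e])\<^esub>"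
      using rx_le[OF h \<open>conj_ax zs (w # ws) \<preceq>\<^bsub>LPrd C zs\<^esub> \<F>\<^bsub>LPrd C zs\<^esub>\<close>
          conj_ax_in[OF Cons.prems(3)] bot_in[OF LPrd_obj[OF zs]]]
      unfolding rx_conj_ax[OF Cons.prems(3) us(1) equalityD2[OF us(2)]] rx_bot[OF h] .
    \<comment> \<open>The head axiom is dropped while \<open>e\<close> stays in the list, so the
      induction hypothesis is used over \<open>us @ [e]\<close>.\<close>
    then have "conj_ax (us @ [e]) ws \<preceq>\<^bsub>LPrd C (us @ [e])\<^esub> \<F>\<^bsub>LPrd C (us @ [e])\<^esub>"
      using henkin_axiom_conservative[OF D B conj_ax_in[OF covus] f]
        ax_snoc[OF w us(1)[unfolded e_def] Xus] e(2) drop by (simp add: e_def)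
    with Cons.IH[OF _ _ covws] Cons.prems(1,2) show False by simp
  qed
qed

section \<open>Passage to sentences with constants\<close>

abbreviation T :: 'o where "T \<equiv> Trm C"

abbreviation L :: "('o, 'p, 'l) cform gorder" where
  "L \<equiv> Fib (const_doctrine P \<Lambda>) T"

lemma rx_wk_pr1:
  assumes xs: "xs \<in> Ctx C \<Lambda>" and zs: "zs \<in> Ctx C \<Lambda>" and sub: "set xs \<subseteq> set zs"
    and x: "x \<in> carrier (Fib P (LPrd C xs))"
  shows "Rx P (wk C zs xs T) (Rx P (Pr1 C (LPrd C xs) T) x)
    = Rx P (Pr1 C (LPrd C zs) T) (Rx P (ctx_proj C zs xs) x)"
proof -
  note p = ctx_proj_hom[OF xs zs sub]
  note q = pr1_hom[OF LPrd_obj[OF xs] trm_obj] and r = pr1_hom[OF LPrd_obj[OF zs] trm_obj]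
  show ?thesis
    by (simp add: rx_comp[OF times_id_hom[OF p trm_obj] q x, symmetric] rx_comp[OF r p x, symmetric]
        pr1_times_id[OF p trm_obj])
qed

text \<open>The projection from \<open>D \<bullet> T\<close> has the section that pairs the identity
  with the terminal arrow; reindexing along it undoes the reindexing along the projection.\<close>

lemma rx_pr1_trm_reflects_le:
  assumes D: "D \<in> Obj C" and x: "x \<in> carrier (Fib P D)" and y: "y \<in> carrier (Fib P D)"
    and le: "Rx P (Pr1 C D T) x \<preceq>\<^bsub>D \<bullet> T\<^esub> Rx P (Pr1 C D T) y"
  shows "x \<preceq>\<^bsub>D\<^esub> y"
proof -
  obtain f where f: "f \<in> Hom C D T" using trm_univ[OF D] by blast
  note i = ide_hom[OF D]
  note s = pair_hom[OF i f] and p = pr1_hom[OF D trm_obj]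
  have "Rx P (pair C (Ide C D) f) (Rx P (Pr1 C D T) z) = z" if "z \<in> carrier (Fib P D)" for z
    using rx_comp[OF s p that] pr1_pair[OF i f] rx_ide[OF D that] by simp
  with rx_le[OF s le rx_in[OF p x] rx_in[OF p y]] x y show ?thesis by simp
qed

lemma henkin_axiom_eq:
  "henkin_axiom P \<Lambda> \<phi> X (fst w) (snd w) = form_cls P \<Lambda> T
    (Rx P (Pr1 C (LPrd C (Xs w)) T) (henkin_form P \<phi> X (fst w) (snd w))) (Xs w)"
  by (simp add: henkin_axiom_def)

lemma henkin_axiom_rep:
  "w \<in> Idx \<Longrightarrow> (Rx P (Pr1 C (LPrd C (Xs w)) T) (henkin_form P \<phi> X (fst w) (snd w)), Xs w)
    \<in> form_reps P \<Lambda> T"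
  using rx_in[OF pr1_hom[OF LPrd_obj[OF Xs_in] trm_obj] henkin_form_in] Xs_in by (simp add: form_reps_iff)

lemma henkin_axiom_in: "w \<in> Idx \<Longrightarrow> henkin_axiom P \<Lambda> \<phi> X (fst w) (snd w) \<in> carrier L"
  unfolding henkin_axiom_eq by (rule form_cls_in[OF henkin_axiom_rep])

lemma henkin_conj_greatest:
  assumes "W \<in> axiom_sets P \<Lambda>"
  shows "greatest L (henkin_conj P \<Lambda> \<phi> X W)
    (Lower L ((\<lambda>w. henkin_axiom P \<Lambda> \<phi> X (fst w) (snd w)) ` W))"
proof -
  interpret lower_semilattice L by (rule const_fib_meet[OF trm_obj])
  have "greatest L (\<Sqinter>\<^bsub>L\<^esub> ((\<lambda>w. henkin_axiom P \<Lambda> \<phi> X (fst w) (snd w)) ` W))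
    (Lower L ((\<lambda>w. henkin_axiom P \<Lambda> \<phi> X (fst w) (snd w)) ` W))"
    using assms henkin_axiom_in const_fib_top[OF trm_obj]
    by (intro finite_inf_greatest_top) (auto simp: axiom_sets_def)
  then show ?thesis
    by (simp add: henkin_conj_def case_prod_unfold)
qed

lemma henkin_conj_in: "W \<in> axiom_sets P \<Lambda> \<Longrightarrow> henkin_conj P \<Lambda> \<phi> X W \<in> carrier L"
  by (rule greatest_closed[OF henkin_conj_greatest])

lemma henkin_conj_at_trm:
  "W \<in> axiom_sets P \<Lambda> \<Longrightarrow> henkin_conj_at P \<Lambda> \<phi> X T W = henkin_conj P \<Lambda> \<phi> X W"
  by (simp add: henkin_conj_at_def const_rx_bang_trm henkin_conj_in)

text \<open>Since reindexings preserve bottom, this class is represented by bottom over every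
  list.\<close>

abbreviation falsum :: "('o, 'p, 'l) cform" where
  "falsum \<equiv> form_cls P \<Lambda> T \<F>\<^bsub>T \<bullet> T\<^esub> []"

lemma falsum_rep: "(\<F>\<^bsub>T \<bullet> T\<^esub>, []) \<in> form_reps P \<Lambda> T"
  using bot_in[OF prd_obj[OF trm_obj trm_obj]] by (simp add: form_reps_iff)

text \<open>The witness is the class of \<open>conj_ax\<close> over all constants involved. Working
  with a lower bound \<open>m\<close> of the axioms avoids computing \<open>henkin_conj\<close> on
  representatives.\<close>

lemma henkin_axioms_consistent:
  assumes "W \<in> axiom_sets P \<Lambda>"
  obtains m where "m \<in> carrier L" "\<And>w. w \<in> W \<Longrightarrow> m \<sqsubseteq>\<^bsub>L\<^esub> henkin_axiom P \<Lambda> \<phi> X (fst w) (snd w)"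
    "\<not> m \<sqsubseteq>\<^bsub>L\<^esub> falsum"
proof -
  have W: "finite W" "W \<subseteq> Idx" using assms by (auto simp: axiom_sets_def)
  have "\<exists>ws. set ws = W \<and> distinct ws \<and> sorted_wrt (\<lambda>w w'. (d w', d w) \<in> \<Lambda>) ws"
  proof (rule finite_sorted_wrt_list_ex[OF W(1)])
    show "(d y, d x) \<in> \<Lambda> \<or> (d x, d y) \<in> \<Lambda>" if "x \<in> W" "y \<in> W" for x y
      using wo_rel.TOTALS[OF wo] d_in that W(2) by blast
    show "(d z, d x) \<in> \<Lambda>" if "(d y, d x) \<in> \<Lambda>" "(d z, d y) \<in> \<Lambda>" for x y z
      using wo_rel.TRANS[OF wo] that by (blast dest: transD)
  qed
  then obtain ws where ws: "set ws = W" "distinct ws" "sorted_wrt (\<lambda>w w'. (d w', d w) \<in> \<Lambda>) ws"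
    by blast
  obtain zs where zs': "set zs = (\<Union>w\<in>W. set (Xs w))" "distinct zs"
    using finite_distinct_list[of "\<Union>w\<in>W. set (Xs w)"] W(1) by auto
  have cov: "covers zs (set ws)"
    using zs' W Xs_in ws(1) by (fastforce simp: covers_def Ctx_iff)
  note zs = covers_ctx[OF cov]
  note c = conj_ax_in[OF cov]
  have rep: "(Rx P (Pr1 C (LPrd C zs) T) (conj_ax zs ws), zs) \<in> form_reps P \<Lambda> T"
    using zs rx_in[OF pr1_hom[OF LPrd_obj[OF zs] trm_obj] c] by (simp add: form_reps_iff)
  let ?m = "form_cls P \<Lambda> T (Rx P (Pr1 C (LPrd C zs) T) (conj_ax zs ws)) zs"
  have le: "?m \<sqsubseteq>\<^bsub>L\<^esub> henkin_axiom P \<Lambda> \<phi> X (fst w) (snd w)" if w: "w \<in> W" for w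
  proof -
    have wI: "w \<in> Idx" and sub: "set (Xs w) \<subseteq> set zs" using w W zs' by auto
    have "Rx P (wk C vs zs T) (Rx P (Pr1 C (LPrd C zs) T) (conj_ax zs ws)) \<preceq>\<^bsub>LPrd C vs \<bullet> T\<^esub>
        Rx P (wk C vs (Xs w) T) (Rx P (Pr1 C (LPrd C (Xs w)) T) (henkin_form P \<phi> X (fst w) (snd w)))"
      if vs: "vs \<in> Ctx C \<Lambda>" "set zs \<subseteq> set vs" for vs
    proof -
      note cvs = covers_mono[OF cov vs]
      have cw: "covers vs {w}" using cvs w ws(1) by (auto simp: covers_def)
      have "Rx P (Pr1 C (LPrd C vs) T) (conj_ax vs ws) \<preceq>\<^bsub>LPrd C vs \<bullet> T\<^esub> Rx P (Pr1 C (LPrd C vs) T) (ax vs w)"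
        using w ws(1) by (intro rx_le[OF pr1_hom[OF LPrd_obj[OF vs(1)] trm_obj]] conj_ax_le[OF cvs]
            conj_ax_in[OF cvs] ax_in[OF cw]) simp
      then show ?thesis
        unfolding rx_wk_pr1[OF zs vs c] rx_conj_ax[OF cov vs]
          rx_wk_pr1[OF Xs_in[OF wI] vs(1) subset_trans[OF sub vs(2)] henkin_form_in[OF wI]] ax_def .
    qed
    then show ?thesis
      unfolding henkin_axiom_eq le_const_fib form_le_cls[OF rep henkin_axiom_rep[OF wI] trm_obj]
      using zs sub by blast
  qed
  have "\<not> ?m \<sqsubseteq>\<^bsub>L\<^esub> falsum"
  proof
    assume "?m \<sqsubseteq>\<^bsub>L\<^esub> falsum"
    then obtain vs where vs: "vs \<in> Ctx C \<Lambda>" "set zs \<subseteq> set vs" and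
      "Rx P (wk C vs zs T) (Rx P (Pr1 C (LPrd C zs) T) (conj_ax zs ws)) \<preceq>\<^bsub>LPrd C vs \<bullet> T\<^esub>
        Rx P (wk C vs [] T) \<F>\<^bsub>T \<bullet> T\<^esub>"
      unfolding le_const_fib form_le_cls[OF rep falsum_rep trm_obj] by blast
    moreover have "Rx P (wk C vs [] T) \<F>\<^bsub>T \<bullet> T\<^esub> = \<F>\<^bsub>LPrd C vs \<bullet> T\<^esub>"
      using rx_bot[OF wk_hom[OF Ctx_Nil vs(1) _ trm_obj]] by simp
    \<comment> \<open>Both sides are written as reindexings along the projection off the terminal
      factor, which can then be stripped to reach \<open>conj_ax_not_le_bot\<close>.\<close>
    ultimately have "Rx P (Pr1 C (LPrd C vs) T) (conj_ax vs ws) \<preceq>\<^bsub>LPrd C vs \<bullet> T\<^esub>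
        Rx P (Pr1 C (LPrd C vs) T) \<F>\<^bsub>LPrd C vs\<^esub>"
      by (simp add: rx_wk_pr1[OF zs vs c] rx_conj_ax[OF cov vs]
          rx_bot[OF pr1_hom[OF LPrd_obj[OF vs(1)] trm_obj]])
    from rx_pr1_trm_reflects_le[OF LPrd_obj[OF vs(1)] conj_ax_in[OF covers_mono[OF cov vs]]
        bot_in[OF LPrd_obj[OF vs(1)]] this]
    show False
      using conj_ax_not_le_bot[OF ws(2,3) covers_mono[OF cov vs]] by simp
  qed
  with le form_cls_in[OF rep] show ?thesis
    using that by blast
qed

text \<open>The two classes separated are those of the empty conjunction, which is the top of
  \<open>L\<close>, and of \<open>falsum\<close>. An inequality between them would hold modulo
  finitely many axioms, against \<open>henkin_axioms_consistent\<close>.\<close>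

lemma consistent_henkin_doctrine: "consistent (henkin_doctrine P \<Lambda> \<phi> X)"
proof -
  interpret lower_semilattice L by (rule const_fib_meet[OF trm_obj])
  let ?\<psi> = "henkin_conj P \<Lambda> \<phi> X" and ?R = "hrel P \<Lambda> \<phi> X T"
  have e: "{} \<in> axiom_sets P \<Lambda>" by (simp add: axiom_sets_def)
  note top_in = henkin_conj_in[OF e]
  have le_top: "x \<sqsubseteq>\<^bsub>L\<^esub> ?\<psi> {}" if "x \<in> carrier L" for x
    using greatest_le[OF henkin_conj_greatest[OF e]] that by simp
  note bot = form_cls_in[OF falsum_rep]
  have reps: "(?\<psi> {}, {}) \<in> hreps P \<Lambda> \<phi> X T" "(falsum, {}) \<in> hreps P \<Lambda> \<phi> X T"
    using e top_in bot le_top by (simp_all add: hreps_def henkin_conj_at_trm)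
  have "\<not> hle P \<Lambda> \<phi> X T (?R `` {(?\<psi> {}, {})}) (?R `` {(falsum, {})})"
  proof
    assume "hle P \<Lambda> \<phi> X T (?R `` {(?\<psi> {}, {})}) (?R `` {(falsum, {})})"
    then obtain a U b V W where
      aU: "((?\<psi> {}, {}), (a, U)) \<in> ?R" and bV: "((falsum, {}), (b, V)) \<in> ?R"
      and W: "W \<in> axiom_sets P \<Lambda>"
      and le: "a \<sqinter>\<^bsub>L\<^esub> henkin_conj_at P \<Lambda> \<phi> X T W \<sqsubseteq>\<^bsub>L\<^esub> b \<sqinter>\<^bsub>L\<^esub> henkin_conj_at P \<Lambda> \<phi> X T W"
      unfolding hle_def by blast
    \<comment> \<open>The order on classes chooses its own representatives \<open>a\<close> and
      \<open>b\<close>; they agree with the original ones only modulo further axiom sets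
      \<open>W1\<close> and \<open>W2\<close>.\<close>
    from aU obtain W1 where W1: "W1 \<in> axiom_sets P \<Lambda>" and a: "a \<in> carrier L"
      and eq1: "?\<psi> {} \<sqinter>\<^bsub>L\<^esub> ?\<psi> W1 = a \<sqinter>\<^bsub>L\<^esub> ?\<psi> W1"
      by (auto simp: hrel_def hreps_def henkin_conj_at_trm)
    from bV obtain W2 where W2: "W2 \<in> axiom_sets P \<Lambda>" and b: "b \<in> carrier L"
      and eq2: "falsum \<sqinter>\<^bsub>L\<^esub> ?\<psi> W2 = b \<sqinter>\<^bsub>L\<^esub> ?\<psi> W2"
      by (auto simp: hrel_def hreps_def henkin_conj_at_trm)
    \<comment> \<open>A single \<open>m\<close> below all axioms of the three sets can use both
      identifications and the inequality, passing in turn below \<open>a\<close>, \<open>b\<close>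
      and \<open>falsum\<close>.\<close>
    have "W \<union> W1 \<union> W2 \<in> axiom_sets P \<Lambda>"
      using W W1 W2 by (auto simp: axiom_sets_def)
    then obtain m where m: "m \<in> carrier L"
      and ml: "\<And>w. w \<in> W \<union> W1 \<union> W2 \<Longrightarrow> m \<sqsubseteq>\<^bsub>L\<^esub> henkin_axiom P \<Lambda> \<phi> X (fst w) (snd w)"
      and not_le: "\<not> m \<sqsubseteq>\<^bsub>L\<^esub> falsum"
      using henkin_axioms_consistent[of "W \<union> W1 \<union> W2"] by metis
    have below: "m \<sqsubseteq>\<^bsub>L\<^esub> ?\<psi> V" if "V \<in> axiom_sets P \<Lambda>" "V \<subseteq> W \<union> W1 \<union> W2" for V
      using that(2) ml m by (intro greatest_le[OF henkin_conj_greatest[OF that(1)]] Lower_memI) auto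
    note m0 = below[OF W] below[OF W1] below[OF W2]
    note \<psi> = henkin_conj_in[OF W] henkin_conj_in[OF W1] henkin_conj_in[OF W2]
    have "m \<sqsubseteq>\<^bsub>L\<^esub> ?\<psi> {} \<sqinter>\<^bsub>L\<^esub> ?\<psi> W1"
      using m m0 top_in le_top \<psi> by (intro meet_le) auto
    then have "m \<sqsubseteq>\<^bsub>L\<^esub> a"
      unfolding eq1 using le_trans[OF _ meet_left[OF a \<psi>(2)] m meet_closed[OF a \<psi>(2)] a] by blast
    then have "m \<sqsubseteq>\<^bsub>L\<^esub> a \<sqinter>\<^bsub>L\<^esub> ?\<psi> W"
      using m m0 a \<psi> by (intro meet_le) auto
    then have "m \<sqsubseteq>\<^bsub>L\<^esub> b \<sqinter>\<^bsub>L\<^esub> ?\<psi> W"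
      using le_trans[OF _ le[unfolded henkin_conj_at_trm[OF W]] m meet_closed[OF a \<psi>(1)] meet_closed[OF b \<psi>(1)]]
      by blast
    then have "m \<sqsubseteq>\<^bsub>L\<^esub> b"
      using le_trans[OF _ meet_left[OF b \<psi>(1)] m meet_closed[OF b \<psi>(1)] b] by blast
    then have "m \<sqsubseteq>\<^bsub>L\<^esub> falsum \<sqinter>\<^bsub>L\<^esub> ?\<psi> W2"
      unfolding eq2 using m m0 b \<psi> by (intro meet_le) auto
    then have "m \<sqsubseteq>\<^bsub>L\<^esub> falsum"
      using le_trans[OF _ meet_left[OF bot \<psi>(3)] m meet_closed[OF bot \<psi>(3)] bot] by blast
    with not_le show False ..
  qed
  moreover have "?R `` {(?\<psi> {}, {})} \<in> carrier (Fib (henkin_doctrine P \<Lambda> \<phi> X) T)"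
    "?R `` {(falsum, {})} \<in> carrier (Fib (henkin_doctrine P \<Lambda> \<phi> X) T)"
    using reps by (auto simp: henkin_doctrine_def intro: quotientI)
  moreover have "Trm (Base (henkin_doctrine P \<Lambda> \<phi> X)) = T"
    by (simp add: henkin_doctrine_def const_cat_def)
  moreover have "le (Fib (henkin_doctrine P \<Lambda> \<phi> X) T) = hle P \<Lambda> \<phi> X T"
    by (simp add: henkin_doctrine_def)
  ultimately show ?thesis
    unfolding consistent_def by metis
qed

end

theorem proposition3p19:
  fixes P :: "('o, 'a, 'p) indexed_poset"
    and \<Lambda> :: "'l rel"
    and \<phi> :: "'o \<Rightarrow> 'l \<Rightarrow> 'p"
    and X :: "'o \<Rightarrow> 'l \<Rightarrow> ('o \<times> 'l) list"
  assumes "boolean_doctrine P"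
    and "existential_doctrine P"
    and "\<And>A. A \<in> Obj (Base P) \<Longrightarrow> \<not> is_singleton (carrier (Fib P A))"
    and "Card_order \<Lambda>"
    and "\<Lambda> =o |SIGMA A : Obj (Base P). carrier (Fib P A)|"
    and "henkin_listing P \<Lambda> \<phi> X"
  shows "consistent (henkin_doctrine P \<Lambda> \<phi> X)"
proof -
  have "henkin P \<Lambda> \<phi> X"
    by (intro henkin.intro henkin_axioms.intro boolean_doctrine.axioms(1)[OF assms(1)] assms(2,3,6)
        card_order_on_well_order_on[OF assms(4)])
  then show ?thesis
    by (rule henkin.consistent_henkin_doctrine)
qed

end
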